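(* For every $j\in\mathbb N$, the function $$\bar E^j_{\vec\alpha}(t)=t^{\alpha-1}E_{\vec\alpha,\alpha}(-\lambda_jt^\alpha,-b_1t^{\alpha-\alpha_1},\dots,-b_mt^{\alpha-\alpha_m}),\qquad t>0,$$ is completely monotone, and $$\int_0^T|\bar E^j_{\vec\alpha}(t)|\,dt<\frac1{\lambda_j}.$$
   Context: $\Omega\subset\mathbb R^d$ ($d\in\{1,2,3\}$) is a bounded convex polygonal (polyhedral) domain, $T>0$ is fixed, $m\ge0$ is an integer, $0<\alpha_m\le\dots\le\alpha_1<\alpha<1$, $b_i>0$ for $i=1,\dots,m$, and $\vec\alpha=(\alpha,\alpha-\alpha_1,\dots,\alpha-\alpha_m)$. $\{\lambda_j\}_{j\ge1}$ are the (positive) eigenvalues of $-\Delta$ on $\Omega$ with homogeneous Dirichlet boundary condition. The multinomial Mittag-Leffler function is $$E_{(\beta_1,\dots,\beta_n),\beta}(z_1,\dots,z_n)=\sum_{k=0}^\infty\ \sum_{l_1+\dots+l_n=k,\ l_i\ge0}\frac{k!}{l_1!\cdots l_n!}\frac{\prod_{i=1}^n z_i^{l_i}}{\Gamma(\beta+\sum_{i=1}^n\beta_il_i)}.$$ A function $g:(0,\infty)\to\mathbb R$ is completely monotone if it is $C^\infty$ and $(-1)^kg^{(k)}(t)\ge0$ for all $t>0$ and all integers $k\ge0$. *)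

theory Defs
  imports "HOL-Analysis.Analysis"
begin

section \<open>Convex polyhedral domains\<close>

definition convex_polyhedral_domain :: "'a::euclidean_space set \<Rightarrow> bool" where
  "convex_polyhedral_domain \<Omega> \<longleftrightarrow>
     open \<Omega> \<and> \<Omega> \<noteq> {} \<and> bounded \<Omega> \<and> convex \<Omega> \<and> polyhedron (closure \<Omega>)"

section \<open>Eigenvalues of the Dirichlet Laplacian\<close>

fun Ck :: "nat \<Rightarrow> ('a::euclidean_space \<Rightarrow> real) \<Rightarrow> bool" where
  "Ck 0 f \<longleftrightarrow> continuous_on UNIV f"
| "Ck (Suc k) f \<longleftrightarrow>
     (\<forall>x. f differentiable (at x)) \<and> (\<forall>v. Ck k (\<lambda>x. frechet_derivative f (at x) v))"

definition test_functions :: "'a::euclidean_space set \<Rightarrow> ('a \<Rightarrow> real) set" where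
  "test_functions \<Omega> =
     {\<phi>. (\<forall>k. Ck k \<phi>) \<and> compact (closure {x. \<phi> x \<noteq> 0}) \<and> closure {x. \<phi> x \<noteq> 0} \<subseteq> \<Omega>}"

definition grad :: "('a::euclidean_space \<Rightarrow> real) \<Rightarrow> 'a \<Rightarrow> 'a" where
  "grad f x = (\<Sum>b\<in>Basis. frechet_derivative f (at x) b *\<^sub>R b)"

definition L2_on :: "'a::euclidean_space set \<Rightarrow> ('a \<Rightarrow> 'b::euclidean_space) set" where
  "L2_on \<Omega> = {u. u \<in> borel_measurable (lebesgue_on \<Omega>) \<and>
                  integrable (lebesgue_on \<Omega>) (\<lambda>x. (norm (u x))\<^sup>2)}"

text \<open>\<open>H10_with_gradient \<Omega> u G\<close>: the function \<open>u\<close> belongs to \<open>H\<^sub>0\<^sup>1(\<Omega>)\<close>, the closure of the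
  test functions in the \<open>H\<^sup>1\<close> norm, and \<open>G\<close> is its (a.e. unique) weak gradient. Only the values
  on \<open>\<Omega>\<close> matter.\<close>

definition H10_with_gradient ::
    "'a::euclidean_space set \<Rightarrow> ('a \<Rightarrow> real) \<Rightarrow> ('a \<Rightarrow> 'a) \<Rightarrow> bool" where
  "H10_with_gradient \<Omega> u G \<longleftrightarrow>
     u \<in> L2_on \<Omega> \<and> G \<in> L2_on \<Omega> \<and>
     (\<exists>\<phi> :: nat \<Rightarrow> 'a \<Rightarrow> real.
        (\<forall>n. \<phi> n \<in> test_functions \<Omega>) \<and>
        (\<lambda>n. LINT x|lebesgue_on \<Omega>. (\<phi> n x - u x)\<^sup>2) \<longlonglongrightarrow> 0 \<and>
        (\<lambda>n. LINT x|lebesgue_on \<Omega>. (norm (grad (\<phi> n) x - G x))\<^sup>2) \<longlonglongrightarrow> 0)"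

text \<open>\<open>- \<Delta> u = \<mu> u\<close> in \<open>\<Omega>\<close> in the sense of distributions, with \<open>u = 0\<close> on the boundary expressed
  by \<open>u \<in> H\<^sub>0\<^sup>1(\<Omega>)\<close>, for some \<open>u\<close> that is not zero almost everywhere.\<close>

definition dirichlet_eigenvalue :: "'a::euclidean_space set \<Rightarrow> real \<Rightarrow> bool" where
  "dirichlet_eigenvalue \<Omega> \<mu> \<longleftrightarrow>
     (\<exists>u G. H10_with_gradient \<Omega> u G \<and>
            \<not> (AE x in lebesgue_on \<Omega>. u x = 0) \<and>
            (\<forall>\<phi>\<in>test_functions \<Omega>.
               (LINT x|lebesgue_on \<Omega>. G x \<bullet> grad \<phi> x) =
               \<mu> * (LINT x|lebesgue_on \<Omega>. u x * \<phi> x)))"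

section \<open>The multinomial Mittag-Leffler function\<close>

text \<open>The parameters \<open>\<beta>\<^sub>1, \<dots>, \<beta>\<^sub>n\<close>, the arguments \<open>z\<^sub>1, \<dots>, z\<^sub>n\<close> and the multi-indices
  \<open>l\<^sub>1, \<dots>, l\<^sub>n\<close> are lists of length \<open>n\<close>, indexed from \<open>0\<close>.\<close>

definition multinomial_ML :: "real list \<Rightarrow> real \<Rightarrow> real list \<Rightarrow> real" where
  "multinomial_ML \<beta>s \<beta> zs =
     (\<Sum>k. \<Sum>l | length l = length zs \<and> sum_list l = k.
        fact k / (\<Prod>i<length zs. fact (l ! i)) *
        ((\<Prod>i<length zs. zs ! i ^ (l ! i)) /
         Gamma (\<beta> + (\<Sum>i<length zs. \<beta>s ! i * real (l ! i)))))"

section \<open>Completely monotone functions on the positive half-line\<close>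

definition completely_monotone :: "(real \<Rightarrow> real) \<Rightarrow> bool" where
  "completely_monotone g \<longleftrightarrow>
     (\<forall>k. \<forall>t>0. ((deriv ^^ k) g) differentiable (at t)) \<and>
     (\<forall>k. \<forall>t>0. (- 1) ^ k * (deriv ^^ k) g t \<ge> 0)"

section \<open>The solution kernel\<close>

text \<open>\<open>a i\<close> is \<open>\<alpha>\<^sub>i\<close>; only \<open>a i\<close> and \<open>b i\<close> with \<open>1 \<le> i \<le> m\<close> are used.\<close>

definition E_bar ::
    "nat \<Rightarrow> real \<Rightarrow> (nat \<Rightarrow> real) \<Rightarrow> (nat \<Rightarrow> real) \<Rightarrow> real \<Rightarrow> real \<Rightarrow> real" where
  "E_bar m \<alpha> a b \<mu> t =
     t powr (\<alpha> - 1) *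
     multinomial_ML (\<alpha> # map (\<lambda>i. \<alpha> - a i) [1..<m + 1]) \<alpha>
       (- \<mu> * t powr \<alpha> # map (\<lambda>i. - b i * t powr (\<alpha> - a i)) [1..<m + 1])"

end

theory Submission
  imports Defs "HOL-Complex_Analysis.Complex_Analysis" "HOL-Real_Asymp.Real_Asymp"
begin

text \<open>The Laplace transform of the kernel is \<open>1 / (\<mu> + s\<^sup>\<alpha> + (\<Sum>i. b i * s powr a i))\<close>. In the variable
  \<open>w = ln s\<close> this is a function without poles on the closed strip \<open>\<bar>Im w\<bar> \<le> \<pi>\<close>, and Cauchy's theorem on
  that strip writes it as a Stieltjes transform \<open>\<integral> \<kappa> x * e\<^sup>x / (e\<^sup>x + s) dx\<close>, where \<open>\<kappa> > 0\<close> because all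
  exponents lie in \<open>(0, 1)\<close>. By uniqueness of Laplace transforms the kernel is then the mixture
  \<open>\<integral> e\<^sup>x * exp (- t * e\<^sup>x) * \<kappa> x dx\<close>, which is completely monotone, and its integral over \<open>(0, T)\<close> is
  \<open>\<integral> (1 - exp (- T * e\<^sup>x)) * \<kappa> x dx < \<integral> \<kappa> x dx = 1 / \<mu>\<close>. That \<open>\<mu> > 0\<close> follows from
  Poincare's inequality.\<close>

section \<open>Positivity of the Dirichlet eigenvalues\<close>

text \<open>The classical route inverts the Laplace transform along a keyhole around the negative
  s-axis. With \<open>s = exp w\<close> the two banks of that cut become the lines Im w = \<pi> and
  Im w = -\<pi>, every power of s becomes an entire function, and no branch of the logarithm has to
  be chosen. Exponents below 1 keep the symbol away from 0 on a strip slightly wider than 2 \<pi>,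
  so both lines lie inside a domain where a primitive exists. The contour argument is used twice:
  once for the Stieltjes transform, and once for the total mass of \<kappa>, whose value 1 / \<mu>
  is the limit of \<open>1 / D\<close> at -\<infinity>. Transforming the Mittag-Leffler series term
  by term is justified only for large s. This is enough, since uniqueness needs the transform only
  along one arithmetic progression s0 + n. Strictness of the integral bound comes from the positive
  remainder \<integral> exp (- T * exp x) * \<kappa> x dx.\<close>

lemma has_real_derivative_integral_dominated:
  fixes f f' :: "real \<Rightarrow> 'b \<Rightarrow> real" and h :: "'b \<Rightarrow> real"
  assumes "0 < d"
    and f: "\<And>s. \<bar>s - t\<bar> < d \<Longrightarrow> integrable M (f s)"
    and deriv: "\<And>s x. \<bar>s - t\<bar> < d \<Longrightarrow> x \<in> space M \<Longrightarrow> ((\<lambda>s. f s x) has_real_derivative f' s x) (at s)"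
    and bound: "\<And>s x. \<bar>s - t\<bar> < d \<Longrightarrow> x \<in> space M \<Longrightarrow> \<bar>f' s x\<bar> \<le> h x"
    and h: "integrable M h" and f': "f' t \<in> borel_measurable M"
  shows "((\<lambda>s. integral\<^sup>L M (f s)) has_real_derivative integral\<^sup>L M (f' t)) (at t)"
proof -
  define B where "B = {t - d<..<t + d}"
  have B: "\<bar>s - t\<bar> < d \<longleftrightarrow> s \<in> B" for s
    by (auto simp: B_def)
  have "t \<in> B"
    using \<open>0 < d\<close> by (simp add: B_def)
  have "((\<lambda>s. (integral\<^sup>L M (f s) - integral\<^sup>L M (f t)) / (s - t)) \<longlongrightarrow> integral\<^sup>L M (f' t)) (at t within B)"
    unfolding tendsto_at_iff_sequentially comp_def
  proof safe
    fix X assume X: "\<forall>i. X i \<in> B - {t}" "X \<longlonglongrightarrow> t"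
    have "(\<lambda>i. integral\<^sup>L M (\<lambda>x. (f (X i) x - f t x) / (X i - t))) \<longlonglongrightarrow> integral\<^sup>L M (f' t)"
    proof (rule integral_dominated_convergence)
      show "AE x in M. (\<lambda>i. (f (X i) x - f t x) / (X i - t)) \<longlonglongrightarrow> f' t x"
      proof (rule AE_I2)
        fix x assume "x \<in> space M"
        then have "((\<lambda>s. (f s x - f t x) / (s - t)) \<longlongrightarrow> f' t x) (at t)"
          using deriv[of t x] \<open>0 < d\<close> by (simp add: has_field_derivative_iff)
        then show "(\<lambda>i. (f (X i) x - f t x) / (X i - t)) \<longlonglongrightarrow> f' t x"
          using X by (auto simp: tendsto_at_iff_sequentially comp_def)
      qed
      show "AE x in M. norm ((f (X i) x - f t x) / (X i - t)) \<le> h x" for i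
      proof (rule AE_I2)
        fix x assume x: "x \<in> space M"
        \<comment> \<open>The mean value inequality on the interval \<open>B\<close> turns the bound
          on \<open>f'\<close> into a bound on the difference quotients, which is the domination
          required.\<close>
        have "norm (f (X i) x - f t x) \<le> h x * norm (X i - t)"
        proof (rule field_differentiable_bound[where S = B and f' = "\<lambda>s. f' s x"])
          show "((\<lambda>s. f s x) has_real_derivative f' s x) (at s within B)" if "s \<in> B" for s
            using deriv[of s x] x that by (auto simp: B intro: has_field_derivative_at_within)
        qed (use bound x X \<open>t \<in> B\<close> in \<open>auto simp: B B_def\<close>)
        moreover have "X i - t \<noteq> 0"
          using X by auto
        ultimately show "norm ((f (X i) x - f t x) / (X i - t)) \<le> h x"
          by (simp add: divide_simps)
      qed
    qed (use f f' h X \<open>t \<in> B\<close> in \<open>auto simp: B borel_measurable_integrable\<close>)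
    then show "(\<lambda>i. (integral\<^sup>L M (f (X i)) - integral\<^sup>L M (f t)) / (X i - t)) \<longlonglongrightarrow> integral\<^sup>L M (f' t)"
      using f X \<open>t \<in> B\<close> by (simp add: B)
  qed
  moreover have "at t within B = at t"
    using \<open>t \<in> B\<close> by (intro at_within_open) (auto simp: B_def)
  ultimately show ?thesis
    by (simp add: has_field_derivative_iff)
qed

lemma integrable_continuous_compact_support:
  fixes f :: "'a::euclidean_space \<Rightarrow> 'b::{banach, second_countable_topology}"
  assumes "continuous_on UNIV f" "compact K" "\<And>x. x \<notin> K \<Longrightarrow> f x = 0"
  shows "integrable lborel f"
proof -
  have "integrable lborel (\<lambda>x. indicator K x *\<^sub>R f x)"
    using assms by (intro borel_integrable_compact) (auto intro: continuous_on_subset)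
  moreover have "indicator K x *\<^sub>R f x = f x" for x
    using assms(3)[of x] by (auto simp: indicator_def)
  ultimately show ?thesis
    by simp
qed

text \<open>The Sobolev definitions integrate over \<open>lebesgue_on \<Omega>\<close>, while
  translation invariance is used for \<open>lborel\<close>. For functions vanishing outside a
  compact subset of \<Omega> the two integrals coincide.\<close>

lemma lebesgue_on_continuous_compact_support:
  fixes f :: "'a::euclidean_space \<Rightarrow> 'b::{banach, second_countable_topology}"
  assumes "continuous_on UNIV f" "compact K" "\<And>x. x \<notin> K \<Longrightarrow> f x = 0" "K \<subseteq> \<Omega>" "open \<Omega>"
  shows "integrable (lebesgue_on \<Omega>) f" "integral\<^sup>L (lebesgue_on \<Omega>) f = integral\<^sup>L lborel f"
proof -
  have int: "integrable lborel f"
    using assms by (intro integrable_continuous_compact_support)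
  then have meas: "f \<in> borel_measurable lborel"
    by (rule borel_measurable_integrable)
  have eq: "indicator \<Omega> x *\<^sub>R f x = f x" for x
    using assms(3)[of x] assms(4) by (auto simp: indicator_def)
  have \<Omega>: "\<Omega> \<inter> space lebesgue \<in> sets lebesgue"
    using assms(5) by auto
  show "integrable (lebesgue_on \<Omega>) f"
    using int by (simp only: integrable_restrict_space[OF \<Omega>] eq integrable_completion[OF meas])
  show "integral\<^sup>L (lebesgue_on \<Omega>) f = integral\<^sup>L lborel f"
    by (simp only: integral_restrict_space[OF \<Omega>] eq integral_completion[OF meas])
qed

text \<open>By translation invariance \<open>\<integral> \<psi> (x + s v) dx\<close> does not depend on \<open>s\<close>.\<close>

lemma integral_directional_derivative_eq_0:
  fixes \<psi> :: "'a::euclidean_space \<Rightarrow> real" and v :: 'a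
  assumes deriv: "\<And>x. (\<psi> has_derivative \<psi>' x) (at x)"
    and cont: "continuous_on UNIV (\<lambda>x. \<psi>' x v)"
    and supp: "\<And>x. x \<notin> cball 0 R \<Longrightarrow> \<psi> x = 0"
  shows "(\<integral>x. \<psi>' x v \<partial>lborel) = 0"
proof -
  have cont_\<psi>: "continuous_on UNIV \<psi>"
    using deriv by (auto intro!: continuous_at_imp_continuous_on has_derivative_continuous)
  have supp': "\<psi>' x v = 0" if "x \<notin> cball 0 R" for x
  proof -
    have "(\<psi> has_derivative (\<lambda>_. 0)) (at x)"
      by (rule has_derivative_transform_within_open[of "\<lambda>_. 0" _ _ _ "- cball 0 R"]) (use that supp in auto)
    from has_derivative_unique[OF deriv this] show ?thesis
      by simp
  qed
  have "compact ((\<lambda>x. \<psi>' x v) ` cball 0 R)"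
    by (intro compact_continuous_image continuous_on_subset[OF cont]) auto
  then obtain C where C: "\<And>x. x \<in> cball 0 R \<Longrightarrow> \<bar>\<psi>' x v\<bar> \<le> C"
    using compact_imp_bounded bounded_real by (metis imageI)
  \<comment> \<open>Enlarging the radius by \<open>norm v\<close> lets one integrable majorant serve
    all translates with \<bar>s\<bar> < 1.\<close>
  let ?K = "cball 0 (R + norm v) :: 'a set"
  have outside: "x + s *\<^sub>R v \<notin> cball 0 R" if "x \<notin> ?K" "\<bar>s\<bar> < 1" for x s
  proof -
    have "norm x \<le> norm (x + s *\<^sub>R v) + norm (s *\<^sub>R v)"
      by (metis add_diff_cancel_right' norm_triangle_ineq4)
    moreover have "norm (s *\<^sub>R v) \<le> norm v"
      using that(2) by (simp add: mult_left_le_one_le)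
    ultimately show ?thesis
      using that(1) by simp
  qed
  have "((\<lambda>s. \<integral>x. \<psi> (x + s *\<^sub>R v) \<partial>lborel) has_real_derivative (\<integral>x. \<psi>' (x + 0 *\<^sub>R v) v \<partial>lborel)) (at 0)"
  proof (rule has_real_derivative_integral_dominated[where d = 1 and h = "\<lambda>x. indicator ?K x * \<bar>C\<bar>"
        and f' = "\<lambda>s x. \<psi>' (x + s *\<^sub>R v) v"])
    fix s :: real and x :: 'a
    assume "\<bar>s - 0\<bar> < 1"
    then have s: "\<bar>s\<bar> < 1"
      by simp
    show "integrable lborel (\<lambda>x. \<psi> (x + s *\<^sub>R v))"
    proof (rule integrable_continuous_compact_support)
      show "continuous_on UNIV (\<lambda>x. \<psi> (x + s *\<^sub>R v))"
        by (intro continuous_on_compose2[OF cont_\<psi>] continuous_intros) auto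
      show "\<psi> (x + s *\<^sub>R v) = 0" if "x \<notin> ?K" for x
        using outside[OF that s] by (rule supp)
    qed simp
    have "((\<lambda>s. \<psi> (x + s *\<^sub>R v)) has_derivative (\<lambda>h. \<psi>' (x + s *\<^sub>R v) (h *\<^sub>R v))) (at s)"
      by (rule has_derivative_compose[OF _ deriv]) (auto intro!: derivative_eq_intros)
    moreover have "\<psi>' (x + s *\<^sub>R v) (h *\<^sub>R v) = \<psi>' (x + s *\<^sub>R v) v * h" for h
      using linear_scale[OF has_derivative_linear[OF deriv]] by (simp add: mult.commute)
    ultimately show "((\<lambda>s. \<psi> (x + s *\<^sub>R v)) has_real_derivative \<psi>' (x + s *\<^sub>R v) v) (at s)"
      by (simp add: has_field_derivative_def)
    show "\<bar>\<psi>' (x + s *\<^sub>R v) v\<bar> \<le> indicator ?K x * \<bar>C\<bar>"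
    proof (cases "x + s *\<^sub>R v \<in> cball 0 R")
      case True
      then have "x \<in> ?K"
        using outside s by blast
      with C[OF True] show ?thesis
        by simp
    qed (simp add: supp')
  next
    show "integrable lborel (\<lambda>x. indicator ?K x * \<bar>C\<bar>)"
      using borel_integrable_compact[of ?K "\<lambda>_. \<bar>C\<bar>"] by simp
  qed (use cont in \<open>auto intro!: borel_measurable_continuous_onI\<close>)
  moreover have "(\<integral>x. \<psi> (x + s *\<^sub>R v) \<partial>lborel) = integral\<^sup>L lborel \<psi>" for s
  proof -
    have "\<psi> \<in> borel_measurable borel"
      using cont_\<psi> by (rule borel_measurable_continuous_onI)
    then have "integral\<^sup>L (distr lborel borel ((+) (s *\<^sub>R v))) \<psi> = (\<integral>x. \<psi> (s *\<^sub>R v + x) \<partial>lborel)"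
      by (intro integral_distr) auto
    then show ?thesis
      by (simp add: lborel_distr_plus add.commute)
  qed
  ultimately have "((\<lambda>s. integral\<^sup>L lborel \<psi>) has_real_derivative (\<integral>x. \<psi>' x v \<partial>lborel)) (at 0)"
    by simp
  from DERIV_unique[OF this DERIV_const] show ?thesis .
qed

section \<open>Test functions and Poincare's inequality\<close>

context
  fixes \<phi> :: "'a::euclidean_space \<Rightarrow> real" and \<Omega>
  assumes \<phi>: "\<phi> \<in> test_functions \<Omega>"
begin

lemma test_function_has_derivative: "(\<phi> has_derivative frechet_derivative \<phi> (at x)) (at x)"
proof -
  have "Ck (Suc 0) \<phi>"
    using \<phi> unfolding test_functions_def by blast
  then show ?thesis
    by (simp add: frechet_derivative_works)
qed

lemma continuous_on_test_function: "continuous_on UNIV \<phi>"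
  using test_function_has_derivative
  by (auto intro!: continuous_at_imp_continuous_on has_derivative_continuous)

lemma continuous_on_frechet_test_function: "continuous_on UNIV (\<lambda>x. frechet_derivative \<phi> (at x) v)"
proof -
  have "Ck (Suc 0) \<phi>"
    using \<phi> unfolding test_functions_def by blast
  then show ?thesis
    by simp
qed

lemma test_function_support:
  obtains K where "compact K" "K \<subseteq> \<Omega>" "\<And>x. x \<notin> K \<Longrightarrow> \<phi> x = 0" "\<And>x. x \<notin> K \<Longrightarrow> grad \<phi> x = 0"
proof -
  define K where "K = closure {x. \<phi> x \<noteq> 0}"
  have K: "compact K" "K \<subseteq> \<Omega>"
    using \<phi> by (auto simp: test_functions_def K_def)
  have zero: "\<phi> x = 0" if "x \<notin> K" for x
    using that closure_subset[of "{x. \<phi> x \<noteq> 0}"] by (auto simp: K_def)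
  have "grad \<phi> x = 0" if "x \<notin> K" for x
  proof -
    have "(\<phi> has_derivative (\<lambda>_. 0)) (at x)"
    proof (rule has_derivative_transform_within_open[where s = "- K"])
      show "open (- K)"
        by (simp add: K_def open_Compl)
    qed (use that zero in simp_all)
    then have "frechet_derivative \<phi> (at x) = (\<lambda>_. 0)"
      using has_derivative_unique[OF test_function_has_derivative] by metis
    then show ?thesis
      by (simp add: grad_def)
  qed
  with K zero show thesis
    by (rule that)
qed

lemma continuous_on_grad_test_function: "continuous_on UNIV (grad \<phi>)"
  unfolding grad_def[abs_def] by (intro continuous_intros continuous_on_frechet_test_function)

lemma grad_inner_Basis: "e \<in> Basis \<Longrightarrow> grad \<phi> x \<bullet> e = frechet_derivative \<phi> (at x) e"
  unfolding grad_def by simp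

text \<open>Integrate the derivative of \<open>(x \<bullet> e) (\<phi> x)\<^sup>2\<close> in the direction \<open>e\<close>.\<close>

lemma poincare_lborel:
  assumes R: "\<And>x. x \<in> \<Omega> \<Longrightarrow> norm x \<le> R"
  shows "(\<integral>x. (\<phi> x)\<^sup>2 \<partial>lborel) \<le> 4 * R\<^sup>2 * (\<integral>x. (norm (grad \<phi> x))\<^sup>2 \<partial>lborel)"
proof -
  obtain K where K: "compact K" "K \<subseteq> \<Omega>" "\<And>x. x \<notin> K \<Longrightarrow> \<phi> x = 0" "\<And>x. x \<notin> K \<Longrightarrow> grad \<phi> x = 0"
    using test_function_support by blast
  obtain e :: 'a where e: "e \<in> Basis"
    using nonempty_Basis by blast
  let ?D = "\<lambda>x. frechet_derivative \<phi> (at x) e"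
  have D: "?D x = grad \<phi> x \<bullet> e" for x
    using grad_inner_Basis[OF e] by simp
  have int1: "integrable lborel (\<lambda>x. (\<phi> x)\<^sup>2)"
    by (rule integrable_continuous_compact_support[OF _ K(1)])
      (use K in \<open>auto intro!: continuous_intros continuous_on_test_function\<close>)
  have int2: "integrable lborel (\<lambda>x. 2 * (x \<bullet> e) * \<phi> x * ?D x)"
    by (rule integrable_continuous_compact_support[OF _ K(1)])
      (use K in \<open>auto intro!: continuous_intros continuous_on_test_function continuous_on_frechet_test_function\<close>)
  have int3: "integrable lborel (\<lambda>x. (norm (grad \<phi> x))\<^sup>2)"
    by (rule integrable_continuous_compact_support[OF _ K(1)])
      (use K in \<open>auto intro!: continuous_intros continuous_on_grad_test_function\<close>)
  have "(\<integral>x. (\<phi> x)\<^sup>2 + 2 * (x \<bullet> e) * \<phi> x * ?D x \<partial>lborel) = 0"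
  proof -
    let ?\<psi>' = "\<lambda>x h. (h \<bullet> e) * (\<phi> x)\<^sup>2 + 2 * (x \<bullet> e) * \<phi> x * frechet_derivative \<phi> (at x) h"
    have "(\<integral>x. ?\<psi>' x e \<partial>lborel) = 0"
    proof (rule integral_directional_derivative_eq_0[where \<psi>' = ?\<psi>' and v = e])
      show "((\<lambda>x. (x \<bullet> e) * (\<phi> x)\<^sup>2) has_derivative ?\<psi>' x) (at x)" for x
        by (auto intro!: derivative_eq_intros test_function_has_derivative simp: algebra_simps)
      show "continuous_on UNIV (\<lambda>x. ?\<psi>' x e)"
        by (intro continuous_intros continuous_on_test_function continuous_on_frechet_test_function)
      show "(x \<bullet> e) * (\<phi> x)\<^sup>2 = 0" if "x \<notin> cball 0 R" for x
        using that K R by (cases "x \<in> K") auto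
    qed
    then show ?thesis
      using e by (simp add: inner_same_Basis)
  qed
  then have "(\<integral>x. (\<phi> x)\<^sup>2 \<partial>lborel) = (\<integral>x. - (2 * (x \<bullet> e) * \<phi> x * ?D x) \<partial>lborel)"
    using int1 int2 by simp
  \<comment> \<open>Young's inequality, weighted so that half of the integral of
    \<open>(\<phi> x)\<^sup>2\<close> can be absorbed on the left; doubling the remaining
    \<open>2 * R\<^sup>2\<close> gives the constant \<open>4 * R\<^sup>2\<close>.\<close>
  also have "\<dots> \<le> (\<integral>x. (\<phi> x)\<^sup>2 / 2 + 2 * R\<^sup>2 * (norm (grad \<phi> x))\<^sup>2 \<partial>lborel)"
  proof (rule integral_mono)
    fix x
    have "\<bar>(x \<bullet> e) * ?D x\<bar> \<le> R * norm (grad \<phi> x)"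
    proof (cases "x \<in> K")
      case True
      then have "\<bar>x \<bullet> e\<bar> \<le> R" "0 \<le> R"
        using K(2) R[of x] Basis_le_norm[OF e, of x] norm_ge_zero[of x] by (auto intro: order.trans)
      then show ?thesis
        unfolding abs_mult D using Basis_le_norm[OF e] by (intro mult_mono) auto
    qed (simp add: D K)
    then have "((x \<bullet> e) * ?D x)\<^sup>2 \<le> (R * norm (grad \<phi> x))\<^sup>2"
      by (metis abs_ge_zero power2_abs power_mono)
    moreover have "- (2 * (\<phi> x * ((x \<bullet> e) * ?D x))) \<le> (\<phi> x)\<^sup>2 / 2 + 2 * ((x \<bullet> e) * ?D x)\<^sup>2"
      using zero_le_power2[of "\<phi> x + 2 * ((x \<bullet> e) * ?D x)"] by (simp add: power2_sum power_mult_distrib)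
    ultimately show "- (2 * (x \<bullet> e) * \<phi> x * ?D x) \<le> (\<phi> x)\<^sup>2 / 2 + 2 * R\<^sup>2 * (norm (grad \<phi> x))\<^sup>2"
      by (simp add: power_mult_distrib mult_ac)
  qed (use int1 int2 int3 in auto)
  also have "\<dots> = (\<integral>x. (\<phi> x)\<^sup>2 \<partial>lborel) / 2 + 2 * R\<^sup>2 * (\<integral>x. (norm (grad \<phi> x))\<^sup>2 \<partial>lborel)"
    using int1 int3 by simp
  finally show ?thesis
    by simp
qed

lemma test_function_L2:
  assumes "open \<Omega>"
  shows "integrable (lebesgue_on \<Omega>) (\<lambda>x. (\<phi> x)\<^sup>2)" "integrable (lebesgue_on \<Omega>) (\<lambda>x. (norm (grad \<phi> x))\<^sup>2)"
    "\<phi> \<in> borel_measurable (lebesgue_on \<Omega>)" "grad \<phi> \<in> borel_measurable (lebesgue_on \<Omega>)"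
    and poincare: "(\<And>x. x \<in> \<Omega> \<Longrightarrow> norm x \<le> R) \<Longrightarrow>
      (LINT x|lebesgue_on \<Omega>. (\<phi> x)\<^sup>2) \<le> 4 * R\<^sup>2 * (LINT x|lebesgue_on \<Omega>. (norm (grad \<phi> x))\<^sup>2)"
proof -
  obtain K where K: "compact K" "K \<subseteq> \<Omega>" "\<And>x. x \<notin> K \<Longrightarrow> \<phi> x = 0" "\<And>x. x \<notin> K \<Longrightarrow> grad \<phi> x = 0"
    using test_function_support by blast
  have c: "continuous_on UNIV (\<lambda>x. (\<phi> x)\<^sup>2)" "continuous_on UNIV (\<lambda>x. (norm (grad \<phi> x))\<^sup>2)"
    by (intro continuous_intros continuous_on_test_function continuous_on_grad_test_function)+
  note 1 = lebesgue_on_continuous_compact_support[OF c(1) K(1) _ K(2) assms]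
  note 2 = lebesgue_on_continuous_compact_support[OF c(2) K(1) _ K(2) assms]
  show "integrable (lebesgue_on \<Omega>) (\<lambda>x. (\<phi> x)\<^sup>2)" "integrable (lebesgue_on \<Omega>) (\<lambda>x. (norm (grad \<phi> x))\<^sup>2)"
    using 1 2 K by auto
  show "\<phi> \<in> borel_measurable (lebesgue_on \<Omega>)" "grad \<phi> \<in> borel_measurable (lebesgue_on \<Omega>)"
    using lebesgue_on_continuous_compact_support(1)[OF continuous_on_test_function K(1) K(3) K(2) assms]
      lebesgue_on_continuous_compact_support(1)[OF continuous_on_grad_test_function K(1) K(4) K(2) assms]
    by (auto dest: borel_measurable_integrable)
  show "(LINT x|lebesgue_on \<Omega>. (\<phi> x)\<^sup>2) \<le> 4 * R\<^sup>2 * (LINT x|lebesgue_on \<Omega>. (norm (grad \<phi> x))\<^sup>2)"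
    if "\<And>x. x \<in> \<Omega> \<Longrightarrow> norm x \<le> R"
    using poincare_lborel[OF that] 1(2) 2(2) K by simp
qed

end

section \<open>Square-integrable functions and the sign of an eigenvalue\<close>

lemma integrable_inner_L2:
  fixes f g :: "'a \<Rightarrow> 'b::euclidean_space"
  assumes [measurable]: "f \<in> borel_measurable M" "g \<in> borel_measurable M"
    and "integrable M (\<lambda>x. (norm (f x))\<^sup>2)" "integrable M (\<lambda>x. (norm (g x))\<^sup>2)"
  shows "integrable M (\<lambda>x. f x \<bullet> g x)"
proof (rule Bochner_Integration.integrable_bound)
  show "integrable M (\<lambda>x. (norm (f x))\<^sup>2 + (norm (g x))\<^sup>2)"
    using assms by simp
  show "AE x in M. norm (f x \<bullet> g x) \<le> norm ((norm (f x))\<^sup>2 + (norm (g x))\<^sup>2)"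
  proof (rule AE_I2)
    fix x
    have "2 * (norm (f x) * norm (g x)) \<le> (norm (f x))\<^sup>2 + (norm (g x))\<^sup>2"
      using sum_squares_bound[of "norm (f x)" "norm (g x)"] by (simp add: mult.assoc)
    moreover have "\<bar>f x \<bullet> g x\<bar> \<le> norm (f x) * norm (g x)"
      by (rule Cauchy_Schwarz_ineq2)
    moreover have "0 \<le> norm (f x) * norm (g x)"
      by simp
    ultimately show "norm (f x \<bullet> g x) \<le> norm ((norm (f x))\<^sup>2 + (norm (g x))\<^sup>2)"
      unfolding real_norm_def by linarith
  qed
qed simp

lemma integrable_diff_L2:
  fixes f g :: "'a \<Rightarrow> 'b::euclidean_space"
  assumes "f \<in> borel_measurable M" "g \<in> borel_measurable M"
    and "integrable M (\<lambda>x. (norm (f x))\<^sup>2)" "integrable M (\<lambda>x. (norm (g x))\<^sup>2)"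
  shows "integrable M (\<lambda>x. (norm (f x - g x))\<^sup>2)"
proof -
  have "(norm (f x - g x))\<^sup>2 = (norm (f x))\<^sup>2 + (norm (g x))\<^sup>2 - 2 * (f x \<bullet> g x)" for x
    by (simp add: power2_norm_eq_inner inner_diff inner_commute)
  then show ?thesis
    using assms integrable_inner_L2[OF assms] by simp
qed

text \<open>The weak equation may be tested only with test functions, not with \<open>u\<close>
  itself, so it is tested with the approximants \<open>\<phi> n\<close>. If \<mu> \<le> 0, the term
  \<mu> \<integral> (\<phi> n)^2 has a favourable sign, and what remains is controlled by the
  approximation errors \<open>\<delta> n\<close> and \<open>\<epsilon> n\<close>. Hence the
  gradients of \<open>\<phi> n\<close> tend to 0 in L2, by Poincare so do the
  \<open>\<phi> n\<close>, and \<open>u\<close> vanishes almost everywhere.\<close>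

lemma dirichlet_eigenvalue_pos:
  fixes \<Omega> :: "'a::euclidean_space set"
  assumes "open \<Omega>" "bounded \<Omega>" and ev: "dirichlet_eigenvalue \<Omega> \<mu>"
  shows "0 < \<mu>"
proof (rule ccontr)
  assume "\<not> 0 < \<mu>"
  let ?M = "lebesgue_on \<Omega>"
  obtain u G where H: "H10_with_gradient \<Omega> u G" and nz: "\<not> (AE x in ?M. u x = 0)"
    and weak: "\<And>\<phi>. \<phi> \<in> test_functions \<Omega> \<Longrightarrow>
      (LINT x|?M. G x \<bullet> grad \<phi> x) = \<mu> * (LINT x|?M. u x * \<phi> x)"
    using ev unfolding dirichlet_eigenvalue_def by blast
  have u [measurable]: "u \<in> borel_measurable ?M" and u2: "integrable ?M (\<lambda>x. (norm (u x))\<^sup>2)"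
    and G [measurable]: "G \<in> borel_measurable ?M" and G2: "integrable ?M (\<lambda>x. (norm (G x))\<^sup>2)"
    using H by (auto simp: H10_with_gradient_def L2_on_def)
  obtain \<phi> where \<phi>: "\<And>n. \<phi> n \<in> test_functions \<Omega>"
    and \<phi>_lim: "(\<lambda>n. LINT x|?M. (\<phi> n x - u x)\<^sup>2) \<longlonglongrightarrow> 0"
    and grad_lim: "(\<lambda>n. LINT x|?M. (norm (grad (\<phi> n) x - G x))\<^sup>2) \<longlonglongrightarrow> 0"
    using H by (auto simp: H10_with_gradient_def)
  note \<phi>2 = test_function_L2[OF \<phi> \<open>open \<Omega>\<close>]
  obtain R where R: "0 < R" "\<And>x. x \<in> \<Omega> \<Longrightarrow> norm x \<le> R"
    using \<open>bounded \<Omega>\<close> by (auto simp: bounded_pos)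
  define C where "C = 4 * R\<^sup>2"
  have "0 < C"
    using R by (simp add: C_def)
  define X where "X n = (LINT x|?M. (norm (grad (\<phi> n) x))\<^sup>2)" for n
  define Y where "Y n = (LINT x|?M. (\<phi> n x)\<^sup>2)" for n
  define \<delta> where "\<delta> n = (LINT x|?M. (\<phi> n x - u x)\<^sup>2)" for n
  define \<epsilon> where "\<epsilon> n = (LINT x|?M. (norm (grad (\<phi> n) x - G x))\<^sup>2)" for n
  have Y_le: "Y n \<le> C * X n" for n
    unfolding X_def Y_def C_def using R by (intro poincare[OF \<phi> \<open>open \<Omega>\<close>])
  have d_int: "integrable ?M (\<lambda>x. (\<phi> n x - u x)\<^sup>2)" for n
    using integrable_diff_L2[OF \<phi>2(3) u _ u2, of n] \<phi>2(1)[of n] by simp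
  have e_int: "integrable ?M (\<lambda>x. (norm (grad (\<phi> n) x - G x))\<^sup>2)" for n
    by (rule integrable_diff_L2[OF \<phi>2(4) G \<phi>2(2) G2])
  have X_le: "X n \<le> 2 * \<epsilon> n + 2 * (\<mu>\<^sup>2 * C) * \<delta> n" for n
  proof -
    have [measurable]: "grad (\<phi> n) \<in> borel_measurable ?M" "\<phi> n \<in> borel_measurable ?M"
      by (rule \<phi>2)+
    have i1: "integrable ?M (\<lambda>x. grad (\<phi> n) x \<bullet> (grad (\<phi> n) x - G x))"
      by (rule integrable_inner_L2) (simp_all add: \<phi>2 e_int)
    have i2: "integrable ?M (\<lambda>x. G x \<bullet> grad (\<phi> n) x)"
      by (rule integrable_inner_L2) (simp_all add: \<phi>2 G2)
    have i3: "integrable ?M (\<lambda>x. u x * \<phi> n x)"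
      using integrable_inner_L2[OF u \<phi>2(3)[of n] u2] \<phi>2(1)[of n] by simp
    have "X n = (LINT x|?M. grad (\<phi> n) x \<bullet> (grad (\<phi> n) x - G x) + G x \<bullet> grad (\<phi> n) x)"
      unfolding X_def by (intro Bochner_Integration.integral_cong refl)
        (simp add: power2_norm_eq_inner inner_diff_right inner_commute)
    also have "\<dots> = (LINT x|?M. grad (\<phi> n) x \<bullet> (grad (\<phi> n) x - G x)) + \<mu> * (LINT x|?M. u x * \<phi> n x)"
      using i1 i2 by (simp add: weak[OF \<phi>])
    also have "\<dots> = (LINT x|?M. grad (\<phi> n) x \<bullet> (grad (\<phi> n) x - G x) + \<mu> * (u x * \<phi> n x))"
      using i1 i3 by simp
    \<comment> \<open>The weights in Young's inequality are chosen so that each of the two terms in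
      \<open>\<phi> n\<close> costs at most \<open>X n / 4\<close>, the second one after Poincare.
      The resulting \<open>X n / 2\<close> is absorbed on the left.\<close>
    also have "\<dots> \<le> (LINT x|?M. ((norm (grad (\<phi> n) x))\<^sup>2 / 4 + (norm (grad (\<phi> n) x - G x))\<^sup>2)
        + ((\<phi> n x)\<^sup>2 / (4 * C) + \<mu>\<^sup>2 * C * (\<phi> n x - u x)\<^sup>2))"
    proof (rule integral_mono)
      fix x
      have "grad (\<phi> n) x \<bullet> (grad (\<phi> n) x - G x) \<le> norm (grad (\<phi> n) x) * norm (grad (\<phi> n) x - G x)"
        by (rule norm_cauchy_schwarz)
      also have "\<dots> \<le> (norm (grad (\<phi> n) x))\<^sup>2 / 4 + (norm (grad (\<phi> n) x - G x))\<^sup>2"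
        using zero_le_power2[of "norm (grad (\<phi> n) x) / 2 - norm (grad (\<phi> n) x - G x)"]
        by (simp add: power2_diff power_divide)
      finally have 1: "grad (\<phi> n) x \<bullet> (grad (\<phi> n) x - G x)
          \<le> (norm (grad (\<phi> n) x))\<^sup>2 / 4 + (norm (grad (\<phi> n) x - G x))\<^sup>2" .
      \<comment> \<open>Replacing \<open>u\<close> by \<open>\<phi> n\<close> isolates the part
        whose sign is known from \<mu> \<le> 0.\<close>
      have "\<mu> * (u x * \<phi> n x) = \<mu> * (\<phi> n x)\<^sup>2 - \<mu> * (\<phi> n x - u x) * \<phi> n x"
        by (simp add: algebra_simps power2_eq_square)
      also have "\<mu> * (\<phi> n x)\<^sup>2 \<le> 0"
        using \<open>\<not> 0 < \<mu>\<close> by (simp add: mult_nonpos_nonneg)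
      also have "0 - \<mu> * (\<phi> n x - u x) * \<phi> n x \<le> (\<phi> n x)\<^sup>2 / (4 * C) + \<mu>\<^sup>2 * C * (\<phi> n x - u x)\<^sup>2"
      proof -
        have "0 \<le> (\<phi> n x + 2 * C * (\<mu> * (\<phi> n x - u x)))\<^sup>2 / (4 * C)"
          using \<open>0 < C\<close> by simp
        also have "\<dots> = (\<phi> n x)\<^sup>2 / (4 * C) + \<mu> * (\<phi> n x - u x) * \<phi> n x + \<mu>\<^sup>2 * C * (\<phi> n x - u x)\<^sup>2"
          using \<open>0 < C\<close> by (simp add: field_simps power2_eq_square)
        finally show ?thesis
          by linarith
      qed
      finally have 2: "\<mu> * (u x * \<phi> n x) \<le> (\<phi> n x)\<^sup>2 / (4 * C) + \<mu>\<^sup>2 * C * (\<phi> n x - u x)\<^sup>2"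
        by simp
      show "grad (\<phi> n) x \<bullet> (grad (\<phi> n) x - G x) + \<mu> * (u x * \<phi> n x)
        \<le> ((norm (grad (\<phi> n) x))\<^sup>2 / 4 + (norm (grad (\<phi> n) x - G x))\<^sup>2)
          + ((\<phi> n x)\<^sup>2 / (4 * C) + \<mu>\<^sup>2 * C * (\<phi> n x - u x)\<^sup>2)"
        by (rule add_mono[OF 1 2])
    qed (use i1 i3 e_int d_int \<phi>2 in simp_all)
    also have "\<dots> = X n / 4 + \<epsilon> n + (Y n / (4 * C) + \<mu>\<^sup>2 * C * \<delta> n)"
      using e_int d_int \<phi>2 by (simp add: X_def Y_def \<delta>_def \<epsilon>_def)
    also have "\<dots> \<le> X n / 4 + \<epsilon> n + (X n / 4 + \<mu>\<^sup>2 * C * \<delta> n)"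
      using Y_le[of n] \<open>0 < C\<close> by (simp add: field_simps)
    finally show ?thesis
      by simp
  qed
  have u_le: "(LINT x|?M. (u x)\<^sup>2) \<le> 2 * \<delta> n + 2 * (C * (2 * \<epsilon> n + 2 * (\<mu>\<^sup>2 * C) * \<delta> n))" for n
  proof -
    have "(LINT x|?M. (u x)\<^sup>2) \<le> (LINT x|?M. 2 * (\<phi> n x - u x)\<^sup>2 + 2 * (\<phi> n x)\<^sup>2)"
    proof (rule integral_mono)
      fix x
      show "(u x)\<^sup>2 \<le> 2 * (\<phi> n x - u x)\<^sup>2 + 2 * (\<phi> n x)\<^sup>2"
        using zero_le_power2[of "2 * \<phi> n x - u x"] by (simp add: power2_eq_square algebra_simps)
    qed (use u2 d_int \<phi>2 in simp_all)
    also have "\<dots> = 2 * \<delta> n + 2 * Y n"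
      using d_int \<phi>2 by (simp add: Y_def \<delta>_def)
    also have "\<dots> \<le> 2 * \<delta> n + 2 * (C * (2 * \<epsilon> n + 2 * (\<mu>\<^sup>2 * C) * \<delta> n))"
      using order.trans[OF Y_le[of n] mult_left_mono[OF X_le[of n] less_imp_le[OF \<open>0 < C\<close>]]] by simp
    finally show ?thesis .
  qed
  have "(\<lambda>n. 2 * \<delta> n + 2 * (C * (2 * \<epsilon> n + 2 * (\<mu>\<^sup>2 * C) * \<delta> n)))
      \<longlonglongrightarrow> 2 * 0 + 2 * (C * (2 * 0 + 2 * (\<mu>\<^sup>2 * C) * 0))"
    unfolding \<delta>_def \<epsilon>_def by (intro tendsto_intros \<phi>_lim grad_lim)
  then have "(LINT x|?M. (u x)\<^sup>2) \<le> 0"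
    using u_le by (intro LIMSEQ_le_const) auto
  moreover have "0 \<le> (LINT x|?M. (u x)\<^sup>2)"
    by (rule integral_nonneg_AE) simp
  ultimately have "(LINT x|?M. (u x)\<^sup>2) = 0"
    by simp
  then have "AE x in ?M. (u x)\<^sup>2 = 0"
    using u2 by (subst (asm) integral_nonneg_eq_0_iff_AE) auto
  then have "AE x in ?M. u x = 0"
    by simp
  with nz show False ..
qed

section \<open>Stieltjes representation of the symbol\<close>

text \<open>Cauchy's theorem without contours: take a primitive \<open>P\<close> of \<open>q\<close>
  and let \<open>\<Phi> x\<close> be its increment along the vertical segment at abscissa x. The
  derivative of \<open>\<Phi>\<close> is the jump of \<open>q\<close> between the two edges, and its
  limits at both ends are 2 \<pi> i times the limits of \<open>q\<close>. So \<open>H\<close> is a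
  primitive of \<open>\<kappa>\<close> running from -c1 to -c2, and because \<open>\<kappa>\<close>
  is nonnegative, integrability comes with the fundamental theorem. The condition \<pi> < \<theta>
  makes the edges interior points; the finite set \<open>K\<close> admits points where
  \<open>q\<close> is only known to be continuous.\<close>

lemma strip_jump_integral:
  fixes q :: "complex \<Rightarrow> complex" and \<kappa> B1 B2 :: "real \<Rightarrow> real" and c1 c2 \<theta> :: real
  defines "S \<equiv> {w. \<bar>Im w\<bar> < \<theta>}"
  assumes \<theta>: "pi < \<theta>"
    and cont: "continuous_on S q" and "finite K"
    and diff: "\<And>w. w \<in> S - K \<Longrightarrow> q field_differentiable at w"
    and jump: "\<And>x. q (Complex x pi) - q (Complex x (- pi)) = - 2 * of_real pi * \<i> * of_real (\<kappa> x)"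
    and \<kappa>: "\<And>x. 0 \<le> \<kappa> x" "\<And>x. isCont \<kappa> x"
    and bot: "\<forall>\<^sub>F x in at_bot. \<forall>y. \<bar>y\<bar> \<le> pi \<longrightarrow> norm (q (Complex x y) - of_real c1) \<le> B1 x"
      "(B1 \<longlongrightarrow> 0) at_bot"
    and top: "\<forall>\<^sub>F x in at_top. \<forall>y. \<bar>y\<bar> \<le> pi \<longrightarrow> norm (q (Complex x y) - of_real c2) \<le> B2 x"
      "(B2 \<longlongrightarrow> 0) at_top"
  shows "integrable lborel \<kappa>" "integral\<^sup>L lborel \<kappa> = c1 - c2"
proof -
  have S: "S = {w. - \<theta> < Im w} \<inter> {w. Im w < \<theta>}"
    by (auto simp: S_def)
  have "open S" "convex S"
    unfolding S by (auto intro!: open_Int convex_Int open_halfspace_Im_gt open_halfspace_Im_lt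
        convex_halfspace_Im_gt convex_halfspace_Im_lt)
  obtain P where "\<And>w. w \<in> S \<Longrightarrow> (P has_field_derivative q w) (at w within S)"
    using holomorphic_convex_primitive[OF \<open>convex S\<close> \<open>finite K\<close> cont] diff \<open>open S\<close>
    by (auto simp: interior_open)
  then have P: "(P has_field_derivative q w) (at w)" if "w \<in> S" for w
    using that \<open>open S\<close> by (metis at_within_open)
  define \<Phi> where "\<Phi> x = P (Complex x pi) - P (Complex x (- pi))" for x
  have Cx: "Complex x y = of_real x + \<i> * of_real y" for x y
    by (rule complex_eqI) auto
  have \<Phi>_bound: "norm (\<Phi> x - 2 * of_real pi * \<i> * of_real c) \<le> 2 * pi * B"
    if "\<forall>y. \<bar>y\<bar> \<le> pi \<longrightarrow> norm (q (Complex x y) - of_real c) \<le> B" for x c B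
  proof -
    let ?seg = "closed_segment (Complex x (- pi)) (Complex x pi)"
    have seg: "w = Complex x (Im w) \<and> \<bar>Im w\<bar> \<le> pi" if "w \<in> ?seg" for w
      using that by (auto simp: closed_segment_same_Re complex_eq_iff closed_segment_eq_real_ivl)
    \<comment> \<open>The function P w - c w has derivative q w - c, which is at most
      \<open>B\<close> in norm on a segment of length 2 \<pi>.\<close>
    have "norm ((P (Complex x pi) - of_real c * Complex x pi)
             - (P (Complex x (- pi)) - of_real c * Complex x (- pi)))
          \<le> B * norm (Complex x pi - Complex x (- pi))"
    proof (rule field_differentiable_bound[where S = ?seg and f' = "\<lambda>w. q w - of_real c"])
      fix w assume w: "w \<in> ?seg"
      then have "w \<in> S"
        using seg[OF w] \<theta> by (auto simp: S_def)
      show "((\<lambda>w. P w - of_real c * w) has_field_derivative q w - of_real c) (at w within ?seg)"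
        by (rule has_field_derivative_at_within) (auto intro!: derivative_eq_intros P \<open>w \<in> S\<close>)
      show "norm (q w - of_real c) \<le> B"
        using that seg[OF w] by metis
    qed auto
    moreover have "norm (Complex x pi - Complex x (- pi)) = 2 * pi"
      by (simp add: cmod_def real_sqrt_mult)
    moreover have "(P (Complex x pi) - of_real c * Complex x pi)
             - (P (Complex x (- pi)) - of_real c * Complex x (- pi))
         = \<Phi> x - 2 * of_real pi * \<i> * of_real c"
      by (simp add: \<Phi>_def Cx algebra_simps)
    ultimately show ?thesis
      by (simp add: mult.commute)
  qed
  have \<Phi>_lim: "(\<Phi> \<longlongrightarrow> 2 * of_real pi * \<i> * of_real c) F"
    if "\<forall>\<^sub>F x in F. \<forall>y. \<bar>y\<bar> \<le> pi \<longrightarrow> norm (q (Complex x y) - of_real c) \<le> B x" "(B \<longlongrightarrow> 0) F"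
    for F c B
  proof (rule LIM_zero_cancel, rule tendsto_norm_zero_cancel)
    show "((\<lambda>x. norm (\<Phi> x - 2 * of_real pi * \<i> * of_real c)) \<longlongrightarrow> 0) F"
    proof (rule tendsto_sandwich[of "\<lambda>_. 0"])
      show "\<forall>\<^sub>F x in F. norm (\<Phi> x - 2 * of_real pi * \<i> * of_real c) \<le> 2 * pi * B x"
        using that(1) by eventually_elim (rule \<Phi>_bound)
      show "((\<lambda>x. 2 * pi * B x) \<longlongrightarrow> 0) F"
        using tendsto_mult_left[OF that(2), of "2 * pi"] by simp
    qed auto
  qed
  define H where "H x = - (Im (\<Phi> x) / (2 * pi))" for x
  have H_lim: "(H \<longlongrightarrow> - c) F" if "(\<Phi> \<longlongrightarrow> 2 * of_real pi * \<i> * of_real c) F" for F c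
  proof -
    have "(H \<longlongrightarrow> - (Im (2 * of_real pi * \<i> * of_real c) / (2 * pi))) F"
      unfolding H_def by (intro tendsto_intros that) auto
    then show ?thesis by simp
  qed
  have H_deriv: "(H has_real_derivative \<kappa> x) (at x)" for x
  proof -
    have "((\<lambda>x. P (Complex x y)) has_vector_derivative q (Complex x y)) (at x)" if "\<bar>y\<bar> \<le> pi" for y
    proof -
      have "((\<lambda>x. Complex x y) has_vector_derivative 1) (at x)"
        unfolding Cx by (auto intro!: derivative_eq_intros)
      moreover have "Complex x y \<in> S"
        using that \<theta> by (simp add: S_def)
      ultimately show ?thesis
        using field_vector_diff_chain_at[of "\<lambda>x. Complex x y" 1 x P "q (Complex x y)"] P
        by (simp add: o_def)
    qed
    then have "(\<Phi> has_vector_derivative (- 2 * of_real pi * \<i> * of_real (\<kappa> x))) (at x)"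
      unfolding \<Phi>_def jump[symmetric] by (intro has_vector_derivative_diff) auto
    then have "((\<lambda>x. Im (\<Phi> x)) has_vector_derivative Im (- 2 * of_real pi * \<i> * of_real (\<kappa> x))) (at x)"
      by (rule bounded_linear.has_vector_derivative[OF bounded_linear_Im])
    then have "((\<lambda>x. Im (\<Phi> x)) has_real_derivative - 2 * pi * \<kappa> x) (at x)"
      by (simp add: has_real_derivative_iff_has_vector_derivative)
    from DERIV_cmult[OF this, of "- 1 / (2 * pi)"] show ?thesis
      by (simp add: H_def[abs_def])
  qed
  have "((H \<circ> real_of_ereal) \<longlongrightarrow> - c1) (at_right (-\<infinity>))" "((H \<circ> real_of_ereal) \<longlongrightarrow> - c2) (at_left \<infinity>)"
    using H_lim[OF \<Phi>_lim[OF bot]] H_lim[OF \<Phi>_lim[OF top]]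
    by (simp_all add: ereal_tendsto_simps)
  from interval_integral_FTC_nonneg[OF _ H_deriv _ _ this] \<kappa>
  have "set_integrable lborel (einterval (-\<infinity>) \<infinity>) \<kappa>" "(LBINT x=-\<infinity>..\<infinity>. \<kappa> x) = c1 - c2"
    by auto
  then show "integrable lborel \<kappa>" "integral\<^sup>L lborel \<kappa> = c1 - c2"
    by (simp_all add: interval_lebesgue_integral_def set_integrable_def set_lebesgue_integral_def)
qed


section \<open>The symbol on the strip and its Stieltjes density\<close>

locale exponential_symbol =
  fixes I :: "'i set" and c p :: "'i \<Rightarrow> real" and \<mu> :: real
  assumes I: "finite I" "I \<noteq> {}"
    and c: "\<And>i. i \<in> I \<Longrightarrow> 0 < c i"
    and p: "\<And>i. i \<in> I \<Longrightarrow> 0 < p i" "\<And>i. i \<in> I \<Longrightarrow> p i < 1"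
    and \<mu>: "0 < \<mu>"
begin

definition D :: "complex \<Rightarrow> complex" where
  "D w = of_real \<mu> + (\<Sum>i\<in>I. of_real (c i) * exp (of_real (p i) * w))"

definition Dr :: "real \<Rightarrow> real" where
  "Dr x = \<mu> + (\<Sum>i\<in>I. c i * exp (p i * x))"

text \<open>Stieltjes inversion: the jump of \<open>1 / D\<close> across the cut, divided by -2
  \<pi> i. It is real because the values on the two edges are conjugate.\<close>

definition density :: "real \<Rightarrow> real" where
  "density x = - Im (1 / D (Complex x pi)) / pi"

lemma Dr_ge: "\<mu> \<le> Dr x"
  unfolding Dr_def using c by (auto intro!: sum_nonneg simp: less_imp_le)

lemma Dr_pos: "0 < Dr x"
  using Dr_ge[of x] \<mu> by linarith

lemma D_of_real: "D (of_real x) = of_real (Dr x)"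
  unfolding D_def Dr_def by (simp flip: exp_of_real)

lemma D_cnj: "D (cnj w) = cnj (D w)"
  unfolding D_def by (simp add: exp_cnj)

text \<open>All summands of \<open>D (x + i y)\<close> lie in the sector with angles between \<open>0\<close> and \<open>P y\<close>, where
  \<open>P\<close> is the largest exponent; project onto the bisector of that sector.\<close>

lemma D_lower_bound:
  obtains \<theta> \<delta> where "pi < \<theta>" "\<theta> < 2 * pi" "0 < \<delta>"
    "\<And>x y. \<bar>y\<bar> \<le> \<theta> \<Longrightarrow> \<delta> * Dr x \<le> norm (D (Complex x y))"
proof -
  define P where "P = Max (p ` I)"
  have P: "p i \<le> P" if "i \<in> I" for i
    using that I by (simp add: P_def)
  have "P \<in> p ` I"
    using I by (simp add: P_def)
  then have "0 < P" "P < 1"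
    using p by auto
  \<comment> \<open>The bound \<open>pi / P\<close> keeps the half-angle P \<theta> / 2 below \<pi>
    / 2, so that its cosine \<delta> is positive. The bound 2 \<pi> ensures later that
    \<open>exp\<close> takes the value s only once in the strip.\<close>
  then have "pi < min (pi / P) (2 * pi)"
    by (simp add: field_simps)
  then obtain \<theta> where \<theta>: "pi < \<theta>" "\<theta> < min (pi / P) (2 * pi)"
    using dense by blast
  then have P\<theta>: "P * \<theta> < pi"
    using \<open>0 < P\<close> by (simp add: field_simps)
  define \<delta> where "\<delta> = cos (P * \<theta> / 2)"
  have "0 < P * \<theta>"
    using \<theta>(1) \<open>0 < P\<close> pi_gt_zero by (intro mult_pos_pos) linarith+
  then have "0 < \<delta>"
    unfolding \<delta>_def using P\<theta> by (intro cos_gt_zero) auto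
  have "\<delta> * Dr x \<le> norm (D (Complex x y))" if y: "\<bar>y\<bar> \<le> \<theta>" for x y
  proof -
    have cos_ge: "\<delta> \<le> cos (r * y - P * y / 2)" if "0 \<le> r" "r \<le> P" for r
    proof -
      have "\<bar>r * y - P * y / 2\<bar> = \<bar>r - P / 2\<bar> * \<bar>y\<bar>"
        by (simp add: algebra_simps flip: abs_mult)
      also have "\<bar>r - P / 2\<bar> \<le> P / 2"
        using that by linarith
      then have "\<bar>r - P / 2\<bar> * \<bar>y\<bar> \<le> P / 2 * \<theta>"
        using that y by (intro mult_mono) auto
      finally have "\<bar>r * y - P * y / 2\<bar> \<le> P * \<theta> / 2"
        by simp
      moreover have "P * \<theta> / 2 \<le> pi"
        using P\<theta> \<open>0 < P * \<theta>\<close> by linarith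
      ultimately have "cos (P * \<theta> / 2) \<le> cos \<bar>r * y - P * y / 2\<bar>"
        by (intro cos_monotone_0_pi_le) auto
      then show ?thesis
        by (simp add: \<delta>_def)
    qed
    have "\<delta> * Dr x = \<delta> * \<mu> + (\<Sum>i\<in>I. c i * exp (p i * x) * \<delta>)"
      by (simp add: Dr_def algebra_simps sum_distrib_left)
    also have "\<dots> \<le> \<mu> * cos (- (P * y / 2)) + (\<Sum>i\<in>I. c i * exp (p i * x) * cos (p i * y - P * y / 2))"
      using cos_ge[of 0] cos_ge[of "p _"] \<mu> c p P \<open>0 < P\<close>
      by (intro add_mono sum_mono mult_left_mono) (auto simp: less_imp_le mult.commute)
    also have "\<dots> = Re (D (Complex x y) * cis (- (P * y / 2)))"
    proof -
      have "exp (of_real r * Complex x y) * cis (- (P * y / 2))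
          = of_real (exp (r * x)) * cis (r * y - P * y / 2)" for r
      proof -
        have "of_real r * Complex x y = of_real (r * x) + \<i> * of_real (r * y)"
          by (rule complex_eqI) auto
        then show ?thesis
          by (simp only: exp_add exp_of_real cis_conv_exp[symmetric] mult.assoc cis_mult) simp
      qed
      then show ?thesis
        by (simp add: D_def distrib_right sum_distrib_right mult.assoc)
    qed
    also have "\<dots> \<le> norm (D (Complex x y))"
      using complex_Re_le_cmod[of "D (Complex x y) * cis (- (P * y / 2))"] by (simp add: norm_mult)
    finally show ?thesis .
  qed
  with \<theta> \<open>0 < \<delta>\<close> show thesis
    by (intro that[of \<theta> \<delta>]) auto
qed

text \<open>On the upper edge the real constant \<mu> drops out of the imaginary part, and each
  remaining summand carries the sine of an angle \<open>p i * pi\<close> strictly between 0 and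
  \<pi>.\<close>

lemma D_top_nz: "D (Complex x pi) \<noteq> 0" and density_pos: "0 < density x"
proof -
  have exp_Im: "Im (exp (of_real r * Complex x pi)) = exp (r * x) * sin (r * pi)" for r
    by (simp add: Im_exp)
  have "Im (D (Complex x pi)) = (\<Sum>i\<in>I. c i * (exp (p i * x) * sin (p i * pi)))"
    by (simp add: D_def exp_Im)
  also have "\<dots> > 0"
    using I c p by (intro sum_pos mult_pos_pos sin_gt_zero) auto
  finally have im: "0 < Im (D (Complex x pi))" .
  then show nz: "D (Complex x pi) \<noteq> 0"
    by auto
  then have "0 < (cmod (D (Complex x pi)))\<^sup>2"
    by simp
  then have "0 < Im (D (Complex x pi)) / (cmod (D (Complex x pi)))\<^sup>2"
    using im by (intro divide_pos_pos) auto
  then have "0 < - Im (1 / D (Complex x pi))"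
    by (simp add: Im_divide cmod_power2)
  then show "0 < density x"
    unfolding density_def by (intro divide_pos_pos pi_gt_zero)
qed

lemma isCont_density: "isCont density x"
proof -
  have "Complex x pi = of_real x + \<i> * of_real pi" for x
    by (rule complex_eqI) auto
  then have "isCont (\<lambda>x. Complex x pi) x"
    by simp
  then show ?thesis
    unfolding density_def D_def
    by (intro continuous_intros) (use D_top_nz[of x] in \<open>auto simp: D_def\<close>)
qed

lemma density_jump:
  "1 / D (Complex x pi) - 1 / D (Complex x (- pi)) = - 2 * of_real pi * \<i> * of_real (density x)"
proof -
  have "Complex x (- pi) = cnj (Complex x pi)"
    by (simp add: complex_eq_iff)
  then have "1 / D (Complex x (- pi)) = cnj (1 / D (Complex x pi))"
    by (simp add: D_cnj)
  then show ?thesis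
    by (simp only: complex_diff_cnj) (simp add: density_def)
qed

lemma inverse_Dr_at_top: "((\<lambda>x. 1 / Dr x) \<longlongrightarrow> 0) at_top"
proof -
  obtain i where i: "i \<in> I"
    using I by auto
  have "filterlim Dr at_top at_top"
  proof (rule filterlim_at_top_mono)
    show "filterlim (\<lambda>x. c i * exp (p i * x)) at_top at_top"
      using c[OF i] p(1)[OF i] by real_asymp
    have "c i * exp (p i * x) \<le> Dr x" for x
      using member_le_sum[of i I "\<lambda>i. c i * exp (p i * x)"] I i c \<mu> by (simp add: Dr_def less_imp_le)
    then show "\<forall>\<^sub>F x in at_top. c i * exp (p i * x) \<le> Dr x"
      by simp
  qed
  then show ?thesis
    by (intro tendsto_divide_0[OF tendsto_const] filterlim_at_top_imp_at_infinity)
qed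

lemma Dr_at_bot: "(Dr \<longlongrightarrow> \<mu>) at_bot"
proof -
  have "((\<lambda>x. c i * exp (p i * x)) \<longlongrightarrow> 0) at_bot" if "i \<in> I" for i
    using p(1)[OF that] by real_asymp
  then have "((\<lambda>x. \<mu> + (\<Sum>i\<in>I. c i * exp (p i * x))) \<longlongrightarrow> \<mu> + (\<Sum>i\<in>I. 0)) at_bot"
    by (intro tendsto_intros) auto
  then show ?thesis
    by (simp add: Dr_def[abs_def])
qed

lemma field_differentiable_inverse_D:
  assumes "D w \<noteq> 0"
  shows "(\<lambda>w. 1 / D w) field_differentiable at w"
proof -
  have "D holomorphic_on UNIV"
    unfolding D_def[abs_def] by (intro holomorphic_intros)
  then have "D field_differentiable at w"
    by (simp add: holomorphic_on_imp_differentiable_at)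
  with assms show ?thesis
    by (intro field_differentiable_divide) auto
qed

text \<open>Here the jump lemma is applied to \<open>1 / D\<close> itself: only the constant term
  survives at -\<infinity>, giving c1 = 1 / \<mu>, and the growth of \<open>Dr\<close> gives c2 = 0.
  There is no exceptional point.\<close>

lemma density_integral: "integrable lborel density" "integral\<^sup>L lborel density = 1 / \<mu>"
proof -
  obtain \<theta> \<delta> where \<theta>: "pi < \<theta>" and \<delta>: "0 < \<delta>"
    and lower: "\<And>x y. \<bar>y\<bar> \<le> \<theta> \<Longrightarrow> \<delta> * Dr x \<le> norm (D (Complex x y))"
    using D_lower_bound by metis
  have nz: "D (Complex x y) \<noteq> 0" if "\<bar>y\<bar> \<le> \<theta>" for x y
    using lower[OF that, of x] \<delta> Dr_pos[of x] by (auto simp: mult_le_0_iff)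
  have nz': "D w \<noteq> 0" if "w \<in> {w. \<bar>Im w\<bar> < \<theta>}" for w
    using nz[of "Im w" "Re w"] that by simp
  have diff: "(\<lambda>w. 1 / D w) field_differentiable at w" if "w \<in> {w. \<bar>Im w\<bar> < \<theta>} - {}" for w
    using field_differentiable_inverse_D nz' that by auto
  have cont: "continuous_on {w. \<bar>Im w\<bar> < \<theta>} (\<lambda>w. 1 / D w)"
    using diff by (auto intro!: continuous_at_imp_continuous_on field_differentiable_imp_continuous_at)
  have bot: "norm (1 / D (Complex x y) - of_real (1 / \<mu>)) \<le> (Dr x - \<mu>) / (\<delta> * \<mu>\<^sup>2)"
    if "\<bar>y\<bar> \<le> pi" for x y
  proof -
    have y: "\<bar>y\<bar> \<le> \<theta>"
      using that \<theta> by simp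
    have "norm (1 / D (Complex x y) - of_real (1 / \<mu>)) = norm (D (Complex x y) - of_real \<mu>) / (norm (D (Complex x y)) * \<mu>)"
      using nz[OF y] \<mu>
      by (simp add: diff_divide_eq_iff divide_diff_eq_iff norm_divide norm_mult norm_minus_commute mult.commute)
    also have "\<dots> \<le> (Dr x - \<mu>) / (\<delta> * \<mu> * \<mu>)"
    proof (rule frac_le)
      show "norm (D (Complex x y) - of_real \<mu>) \<le> Dr x - \<mu>"
        unfolding D_def Dr_def using c by (auto intro!: sum_norm_le simp: norm_mult less_imp_le)
      show "\<delta> * \<mu> * \<mu> \<le> norm (D (Complex x y)) * \<mu>"
        using order.trans[OF mult_left_mono[OF Dr_ge[of x] less_imp_le[OF \<delta>]] lower[OF y, of x]] \<mu>
        by (intro mult_right_mono) auto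
    qed (use Dr_ge \<delta> \<mu> in auto)
    finally show ?thesis
      by (simp add: power2_eq_square mult.assoc)
  qed
  have bot_lim: "((\<lambda>x. (Dr x - \<mu>) / (\<delta> * \<mu>\<^sup>2)) \<longlongrightarrow> 0) at_bot"
    using tendsto_divide[OF tendsto_diff[OF Dr_at_bot tendsto_const[of \<mu>]] tendsto_const[of "\<delta> * \<mu>\<^sup>2"]] \<delta> \<mu>
    by simp
  have top: "norm (1 / D (Complex x y) - of_real 0) \<le> 1 / \<delta> * (1 / Dr x)" if "\<bar>y\<bar> \<le> pi" for x y
    using lower[of y x] that \<theta> \<delta> Dr_pos[of x] by (auto simp: norm_divide intro!: divide_left_mono mult_pos_pos nz)
  have top_lim: "((\<lambda>x. 1 / \<delta> * (1 / Dr x)) \<longlongrightarrow> 0) at_top"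
    using tendsto_mult_left[OF inverse_Dr_at_top, of "1 / \<delta>"] by simp
  note * = strip_jump_integral[where q = "\<lambda>w. 1 / D w" and K = "{}", OF \<theta> cont finite.emptyI diff
      density_jump less_imp_le[OF density_pos] isCont_density _ bot_lim _ top_lim]
  show "integrable lborel density" "integral\<^sup>L lborel density = 1 / \<mu>"
    using *(1)[of "1 / \<mu>" 0] *(2)[of "1 / \<mu>" 0] bot top by auto
qed

text \<open>Subtracting the constant \<open>G0 = 1 / D (ln s)\<close> removes the pole at \<open>ln s\<close> without changing the
  jump across the strip, because \<open>exp\<close> takes the same value on both edges; it produces the limit
  \<open>- G0\<close> at \<open>+\<infinity>\<close>.\<close>

lemma stieltjes_representation:
  assumes "0 < s"
  shows "integrable lborel (\<lambda>x. density x * exp x / (exp x + s))"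
    and "(\<integral>x. density x * exp x / (exp x + s) \<partial>lborel) = 1 / Dr (ln s)"
proof -
  obtain \<theta> \<delta> where \<theta>: "pi < \<theta>" "\<theta> < 2 * pi" and \<delta>: "0 < \<delta>"
    and lower: "\<And>x y. \<bar>y\<bar> \<le> \<theta> \<Longrightarrow> \<delta> * Dr x \<le> norm (D (Complex x y))"
    using D_lower_bound by metis
  define S where "S = {w. \<bar>Im w\<bar> < \<theta>}"
  define w0 where "w0 = complex_of_real (ln s)"
  define G0 where "G0 = 1 / Dr (ln s)"
  have "0 < G0"
    by (simp add: G0_def Dr_pos)
  have G0: "1 / D w0 = of_real G0"
    by (simp add: G0_def w0_def D_of_real)
  have nz: "D (Complex x y) \<noteq> 0" if "\<bar>y\<bar> \<le> \<theta>" for x y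
    using lower[OF that, of x] \<delta> Dr_pos[of x] by (auto simp: mult_le_0_iff)
  have diffG: "(\<lambda>w. 1 / D w) field_differentiable at w" if "w \<in> S" for w
    using field_differentiable_inverse_D nz[of "Im w" "Re w"] that by (auto simp: S_def)
  have exp_w0: "exp w0 = of_real s"
    using \<open>0 < s\<close> by (simp add: w0_def exp_of_real)
  have exp_ne: "exp w \<noteq> of_real s" if "w \<in> S" "w \<noteq> w0" for w
  proof
    assume "exp w = of_real s"
    then have "exp w = exp w0"
      by (simp add: exp_w0)
    moreover have "\<bar>Im w - Im w0\<bar> < 2 * pi"
      using that(1) \<theta> by (simp add: S_def w0_def)
    ultimately have "w = w0"
      by (rule exp_complex_eqI[rotated])
    with that(2) show False ..
  qed
  \<comment> \<open>The value at \<open>w0\<close> makes \<open>q\<close> continuous: the numerator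
    vanishes there like exp w0 times the derivative of \<open>1 / D\<close>, and the denominator
    like exp w0.\<close>
  define q where "q w = (if w = w0 then deriv (\<lambda>w. 1 / D w) w0
      else exp w * (1 / D w - of_real G0) / (exp w - of_real s))" for w
  have "open S"
  proof -
    have "S = {w. - \<theta> < Im w} \<inter> {w. Im w < \<theta>}"
      by (auto simp: S_def)
    then show ?thesis
      by (simp add: open_Int open_halfspace_Im_gt open_halfspace_Im_lt)
  qed
  have w0S: "w0 \<in> S"
    using order.strict_trans[OF pi_gt_zero \<theta>(1)] by (simp add: S_def w0_def)
  have diff: "q field_differentiable at w" if "w \<in> S - {w0}" for w
  proof -
    have "w \<in> S" "w \<noteq> w0"
      using that by auto
    have "(\<lambda>w. exp w * (1 / D w - of_real G0) / (exp w - of_real s)) field_differentiable at w"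
      by (intro field_differentiable_divide field_differentiable_mult field_differentiable_diff
          field_differentiable_within_exp diffG field_differentiable_const)
        (use exp_ne[of w] \<open>w \<in> S\<close> \<open>w \<noteq> w0\<close> in auto)
    then obtain d where
      "((\<lambda>w. exp w * (1 / D w - of_real G0) / (exp w - of_real s)) has_field_derivative d) (at w)"
      unfolding field_differentiable_def by blast
    moreover have "open (S - {w0})"
      using \<open>open S\<close> by (rule open_delete)
    ultimately have "(q has_field_derivative d) (at w)"
      by (rule has_field_derivative_transform_within_open) (use that in \<open>auto simp: q_def\<close>)
    then show ?thesis
      unfolding field_differentiable_def by blast
  qed
  have "isCont q w0"
  proof -
    have "((\<lambda>w. 1 / D w) has_field_derivative deriv (\<lambda>w. 1 / D w) w0) (at w0)"
      using diffG[OF w0S] by (rule field_differentiable_derivI)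
    then have 1: "(\<lambda>w. (1 / D w - of_real G0) / (w - w0)) \<midarrow>w0\<rightarrow> deriv (\<lambda>w. 1 / D w) w0"
      by (simp add: has_field_derivative_iff G0)
    have "(exp has_field_derivative exp w0) (at w0)"
      by (rule DERIV_exp)
    then have 2: "(\<lambda>w. (exp w - of_real s) / (w - w0)) \<midarrow>w0\<rightarrow> exp w0"
      by (simp add: has_field_derivative_iff exp_w0)
    have "(\<lambda>w. exp w * ((1 / D w - of_real G0) / (w - w0)) / ((exp w - of_real s) / (w - w0)))
        \<midarrow>w0\<rightarrow> exp w0 * deriv (\<lambda>w. 1 / D w) w0 / exp w0"
      by (intro tendsto_intros 1 2) auto
    then have "(\<lambda>w. exp w * ((1 / D w - of_real G0) / (w - w0)) / ((exp w - of_real s) / (w - w0)))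
        \<midarrow>w0\<rightarrow> q w0"
      by (simp add: q_def)
    then have "q \<midarrow>w0\<rightarrow> q w0"
      by (rule Lim_transform_eventually) (auto simp: q_def eventually_at_filter)
    then show ?thesis
      by (simp add: isCont_def)
  qed
  then have cont: "continuous_on S q"
    using diff by (intro continuous_at_imp_continuous_on)
      (metis Diff_iff field_differentiable_imp_continuous_at singletonD)
  have ne: "Complex x y \<noteq> w0" if "x \<noteq> ln s" for x y
    using that by (simp add: w0_def complex_eq_iff)
  have norm_exp: "norm (exp (Complex x y)) = exp x" for x y
    by simp
  have exp_lower: "\<bar>exp x - s\<bar> \<le> norm (exp (Complex x y) - of_real s)" for x y
    using norm_triangle_ineq3[of "exp (Complex x y)" "of_real s"] \<open>0 < s\<close> by simp
  have G_bound: "norm (1 / D (Complex x y)) \<le> 1 / \<delta> * (1 / Dr x)" if "\<bar>y\<bar> \<le> pi" for x y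
    using lower[of y x] that \<theta> \<delta> Dr_pos[of x] by (auto simp: norm_divide intro!: divide_left_mono mult_pos_pos nz)
  have jump: "q (Complex x pi) - q (Complex x (- pi))
      = - 2 * of_real pi * \<i> * of_real (density x * exp x / (exp x + s))" for x
  proof -
    have e: "exp (Complex x pi) = - of_real (exp x)" "exp (Complex x (- pi)) = - of_real (exp x)"
      by (rule complex_eqI; simp add: Re_exp Im_exp)+
    have ne': "Complex x pi \<noteq> w0" "Complex x (- pi) \<noteq> w0"
      by (simp_all add: w0_def complex_eq_iff)
    have pos: "exp x + s > 0"
      using \<open>0 < s\<close> by (simp add: add_pos_pos)
    have "- complex_of_real (exp x) * z / (- of_real (exp x) - of_real s) = of_real (exp x / (exp x + s)) * z" for z
    proof -
      have "- complex_of_real (exp x) - of_real s = - of_real (exp x + s)"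
        by simp
      then show ?thesis
        by (simp only: minus_divide_left[symmetric] minus_divide_right[symmetric]) simp
    qed
    then have "q (Complex x pi) - q (Complex x (- pi))
        = of_real (exp x / (exp x + s)) * (1 / D (Complex x pi) - 1 / D (Complex x (- pi)))"
      unfolding q_def by (simp only: ne' if_False e) (simp only: right_diff_distrib, simp)
    also have "\<dots> = - 2 * of_real pi * \<i> * of_real (density x * exp x / (exp x + s))"
      unfolding density_jump by simp
    finally show ?thesis .
  qed
  \<comment> \<open>The factor \<open>exp w\<close> forces the limit 0 at -\<infinity>, so the whole
    mass comes from the limit at the other end.\<close>
  have bot: "\<forall>\<^sub>F x in at_bot. \<forall>y. \<bar>y\<bar> \<le> pi \<longrightarrow>
      norm (q (Complex x y) - of_real 0) \<le> exp x * (1 / \<delta> * (1 / \<mu>) + G0) / (s - exp x)"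
    using eventually_gt_at_bot[of "ln s"]
  proof eventually_elim
    case (elim x)
    then have "exp x < s"
      using \<open>0 < s\<close> by (metis exp_less_cancel_iff exp_ln)
    show ?case
    proof safe
      fix y :: real
      assume y: "\<bar>y\<bar> \<le> pi"
      have "norm (1 / D (Complex x y) - of_real G0) \<le> 1 / \<delta> * (1 / Dr x) + G0"
        using norm_triangle_ineq4[of "1 / D (Complex x y)" "of_real G0"] G_bound[OF y, of x] \<open>0 < G0\<close> by simp
      also have "\<dots> \<le> 1 / \<delta> * (1 / \<mu>) + G0"
        using \<delta> \<mu> Dr_ge[of x] by (intro add_right_mono mult_left_mono divide_left_mono) (auto simp: Dr_pos)
      finally have "norm (exp (Complex x y)) * norm (1 / D (Complex x y) - of_real G0) \<le> exp x * (1 / \<delta> * (1 / \<mu>) + G0)"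
        unfolding norm_exp by (intro mult_left_mono) auto
      moreover have "s - exp x \<le> norm (exp (Complex x y) - of_real s)"
        using exp_lower[of x y] \<open>exp x < s\<close> by simp
      ultimately show "norm (q (Complex x y) - of_real 0) \<le> exp x * (1 / \<delta> * (1 / \<mu>) + G0) / (s - exp x)"
        using ne[of x y] elim \<open>exp x < s\<close> order.trans[OF norm_ge_zero]
        by (simp add: q_def norm_divide norm_mult) (rule frac_le; force)
    qed
  qed
  have bot_lim: "((\<lambda>x. exp x * (1 / \<delta> * (1 / \<mu>) + G0) / (s - exp x)) \<longlongrightarrow> 0) at_bot"
    using \<open>0 < s\<close> by real_asymp
  have top: "\<forall>\<^sub>F x in at_top. \<forall>y. \<bar>y\<bar> \<le> pi \<longrightarrow>
      norm (q (Complex x y) - of_real (- G0)) \<le> (exp x * (1 / \<delta> * (1 / Dr x)) + s * G0) / (exp x - s)"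
    using eventually_gt_at_top[of "ln s"]
  proof eventually_elim
    case (elim x)
    then have "s < exp x"
      using \<open>0 < s\<close> by (metis exp_less_cancel_iff exp_ln)
    show ?case
    proof safe
      fix y :: real
      assume y: "\<bar>y\<bar> \<le> pi"
      define w where "w = Complex x y"
      have lower': "exp x - s \<le> norm (exp w - of_real s)"
        using exp_lower[of x y] \<open>s < exp x\<close> by (simp add: w_def)
      then have "exp w - of_real s \<noteq> 0"
        using \<open>s < exp x\<close> by auto
      \<comment> \<open>Adding \<open>G0\<close> cancels the leading part of the numerator; after
        division by exp w only \<open>1 / D\<close>, which tends to 0, and a vanishing term
        remain.\<close>
      then have "q w - of_real (- G0) = (exp w * (1 / D w) - of_real (s * G0)) / (exp w - of_real s)"
        using ne[of x y] elim unfolding q_def by (simp add: field_simps w_def[symmetric])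
      moreover have "norm (exp w * (1 / D w) - of_real (s * G0)) \<le> exp x * (1 / \<delta> * (1 / Dr x)) + s * G0"
      proof -
        have "norm (exp w * (1 / D w) - of_real (s * G0)) \<le> norm (exp w) * norm (1 / D w) + s * G0"
          using norm_triangle_ineq4[of "exp w * (1 / D w)" "of_real (s * G0)"] \<open>0 < s\<close> \<open>0 < G0\<close>
          by (simp only: norm_mult norm_of_real) simp
        also have "norm (exp w) = exp x"
          by (simp add: w_def)
        finally show ?thesis
          using mult_left_mono[OF G_bound[OF y, of x], of "exp x"] by (simp add: w_def)
      qed
      ultimately show "norm (q (Complex x y) - of_real (- G0))
          \<le> (exp x * (1 / \<delta> * (1 / Dr x)) + s * G0) / (exp x - s)"
        using lower' \<open>s < exp x\<close> order.trans[OF norm_ge_zero] unfolding w_def[symmetric]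
        by (simp only: norm_divide) (rule frac_le; force)
    qed
  qed
  have top_lim: "((\<lambda>x. (exp x * (1 / \<delta> * (1 / Dr x)) + s * G0) / (exp x - s)) \<longlongrightarrow> 0) at_top"
  proof -
    have "((\<lambda>x. exp x / (exp x - s)) \<longlongrightarrow> 1) at_top"
      by real_asymp
    moreover have "((\<lambda>x. s * G0 / (exp x - s)) \<longlongrightarrow> 0) at_top"
      by real_asymp
    ultimately have "((\<lambda>x. exp x / (exp x - s) * (1 / \<delta> * (1 / Dr x)) + s * G0 / (exp x - s))
        \<longlongrightarrow> 1 * (1 / \<delta> * 0) + 0) at_top"
      by (intro tendsto_intros inverse_Dr_at_top)
    then show ?thesis
      by (simp add: add_divide_distrib mult_ac)
  qed
  have pos: "0 < exp x + s" for x
    using \<open>0 < s\<close> by (rule add_pos_pos[OF exp_gt_zero])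
  have nonneg: "0 \<le> density x * exp x / (exp x + s)" for x
    by (intro divide_nonneg_pos mult_nonneg_nonneg pos less_imp_le[OF density_pos] exp_ge_zero)
  have isCont: "isCont (\<lambda>x. density x * exp x / (exp x + s)) x" for x
    using pos[of x] by (intro isCont_divide isCont_mult isCont_density continuous_intros) simp
  note * = strip_jump_integral[where q = q and K = "{w0}" and \<theta> = \<theta>, folded S_def,
      OF \<theta>(1) cont _ diff jump nonneg isCont bot bot_lim top top_lim]
  show "integrable lborel (\<lambda>x. density x * exp x / (exp x + s))"
    by (rule *(1)) auto
  show "(\<integral>x. density x * exp x / (exp x + s) \<partial>lborel) = 1 / Dr (ln s)"
    using *(2) by (simp add: G0_def)
qed

end

section \<open>Mixtures of exponentials and their Laplace transforms\<close>

text \<open>One term of the exponential series is at most its sum. The bound does not depend on y,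
  so all the integrands below are dominated by multiples of \<open>\<kappa>\<close>.\<close>

lemma power_times_exp_minus_le:
  fixes t y :: real
  assumes "0 < t" "0 \<le> y"
  shows "y ^ n * exp (- t * y) \<le> fact n / t ^ n"
proof -
  have "(t * y) ^ n / fact n \<le> exp (t * y)"
    using assms sum_le_suminf[OF summable_exp_generic[of "t * y"], of "{n}"]
    by (simp add: exp_def divide_inverse mult.commute)
  then show ?thesis
    using assms by (simp add: exp_minus field_simps power_mult_distrib)
qed

section \<open>Derivatives, integral and Laplace transform of a mixture\<close>

locale exponential_mixture =
  fixes \<kappa> :: "real \<Rightarrow> real"
  assumes \<kappa>_pos: "\<And>x. 0 < \<kappa> x" and \<kappa>_integrable: "integrable lborel \<kappa>"
begin

lemma \<kappa>_measurable [measurable]: "\<kappa> \<in> borel_measurable borel"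
  using \<kappa>_integrable borel_measurable_integrable by force

text \<open>With \<lambda> = exp x as decay rate, \<open>mixture n\<close> is the n-th derivative of
  \<open>mixture 0\<close> up to the sign (-1)^n. The solution kernel will be
  \<open>mixture 1\<close>, so \<open>- mixture 0\<close> is an explicit primitive of it.\<close>

definition mixture :: "nat \<Rightarrow> real \<Rightarrow> real" where
  "mixture n t = (\<integral>x. exp x ^ n * exp (- t * exp x) * \<kappa> x \<partial>lborel)"

lemma mixture_integrable:
  assumes "0 < t"
  shows "integrable lborel (\<lambda>x. exp x ^ n * exp (- t * exp x) * \<kappa> x)"
proof (rule Bochner_Integration.integrable_bound)
  show "integrable lborel (\<lambda>x. fact n / t ^ n * \<kappa> x)"
    using \<kappa>_integrable by simp
  show "AE x in lborel. norm (exp x ^ n * exp (- t * exp x) * \<kappa> x) \<le> norm (fact n / t ^ n * \<kappa> x)"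
  proof (rule AE_I2)
    fix x
    have "exp x ^ n * exp (- t * exp x) * \<kappa> x \<le> fact n / t ^ n * \<kappa> x"
      by (intro mult_right_mono power_times_exp_minus_le assms less_imp_le[OF \<kappa>_pos]) auto
    moreover have "0 \<le> exp x ^ n * exp (- t * exp x) * \<kappa> x"
      by (intro mult_nonneg_nonneg less_imp_le[OF \<kappa>_pos]) auto
    ultimately show "norm (exp x ^ n * exp (- t * exp x) * \<kappa> x) \<le> norm (fact n / t ^ n * \<kappa> x)"
      unfolding real_norm_def by linarith
  qed
qed auto

lemma mixture_pos:
  assumes "0 < t"
  shows "0 < mixture n t"
proof -
  have "mixture n t \<noteq> 0"
  proof
    assume "mixture n t = 0"
    then have "AE x in lborel. exp x ^ n * exp (- t * exp x) * \<kappa> x = 0"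
      unfolding mixture_def
      by (subst (asm) integral_nonneg_eq_0_iff_AE[OF mixture_integrable[OF assms]])
        (auto simp: less_imp_le \<kappa>_pos)
    moreover have "exp x ^ n * exp (- t * exp x) * \<kappa> x \<noteq> 0" for x
      using \<kappa>_pos[of x] by simp
    ultimately have "AE x::real in lborel. False"
      by simp
    then show False
      using ae_filter_eq_bot_iff[of "lborel :: real measure"]
      by (simp add: trivial_limit_def)
  qed
  moreover have "0 \<le> mixture n t"
    unfolding mixture_def by (intro integral_nonneg_AE AE_I2) (auto simp: less_imp_le \<kappa>_pos)
  ultimately show ?thesis
    by simp
qed

lemma mixture_has_real_derivative:
  assumes "0 < t"
  shows "(mixture n has_real_derivative - mixture (Suc n) t) (at t)"
proof -
  have "((\<lambda>s. \<integral>x. exp x ^ n * exp (- s * exp x) * \<kappa> x \<partial>lborel) has_real_derivative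
      (\<integral>x. - (exp x ^ Suc n * exp (- t * exp x) * \<kappa> x) \<partial>lborel)) (at t)"
  proof (rule has_real_derivative_integral_dominated[where d = "t / 2"
        and h = "\<lambda>x. fact (Suc n) / (t / 2) ^ Suc n * \<kappa> x"
        and f' = "\<lambda>s x. - (exp x ^ Suc n * exp (- s * exp x) * \<kappa> x)"])
    fix s x :: real
    assume s: "\<bar>s - t\<bar> < t / 2"
    then have s': "t / 2 < s"
      by linarith
    with assms show "integrable lborel (\<lambda>x. exp x ^ n * exp (- s * exp x) * \<kappa> x)"
      by (intro mixture_integrable) simp
    show "((\<lambda>s. exp x ^ n * exp (- s * exp x) * \<kappa> x) has_real_derivative
        - (exp x ^ Suc n * exp (- s * exp x) * \<kappa> x)) (at s)"
      by (auto intro!: derivative_eq_intros)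
    have "exp x ^ Suc n * exp (- s * exp x) \<le> exp x ^ Suc n * exp (- (t / 2) * exp x)"
      using s' by (intro mult_left_mono) auto
    also have "\<dots> \<le> fact (Suc n) / (t / 2) ^ Suc n"
      using assms by (intro power_times_exp_minus_le) auto
    finally have "exp x ^ Suc n * exp (- s * exp x) * \<kappa> x \<le> fact (Suc n) / (t / 2) ^ Suc n * \<kappa> x"
      by (intro mult_right_mono less_imp_le[OF \<kappa>_pos])
    moreover have "0 \<le> exp x ^ Suc n * exp (- s * exp x) * \<kappa> x"
      by (intro mult_nonneg_nonneg less_imp_le[OF \<kappa>_pos]) auto
    ultimately show "\<bar>- (exp x ^ Suc n * exp (- s * exp x) * \<kappa> x)\<bar> \<le> fact (Suc n) / (t / 2) ^ Suc n * \<kappa> x"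
      by (simp only: abs_minus_cancel abs_of_nonneg)
  qed (use assms \<kappa>_integrable in auto)
  then show ?thesis
    by (simp add: mixture_def[abs_def])
qed

text \<open>Agreement is assumed only for t > 0, as that is all that is known of the kernel.
  Derivatives at positive t see only a neighbourhood inside the open half-line, which carries the
  induction.\<close>

lemma iterated_deriv_mixture:
  assumes "\<And>t. 0 < t \<Longrightarrow> f t = mixture n t" "0 < t"
  shows "(deriv ^^ k) f t = (- 1) ^ k * mixture (n + k) t"
    and "(deriv ^^ k) f differentiable (at t)"
proof -
  have "((deriv ^^ k) f has_real_derivative (- 1) ^ Suc k * mixture (n + Suc k) t) (at t)"
    if "0 < t" and eq: "\<And>t. 0 < t \<Longrightarrow> (deriv ^^ k) f t = (- 1) ^ k * mixture (n + k) t" for k t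
  proof (rule has_field_derivative_transform_within_open[where S = "{0<..}"])
    show "((\<lambda>t. (- 1) ^ k * mixture (n + k) t) has_real_derivative (- 1) ^ Suc k * mixture (n + Suc k) t) (at t)"
      using DERIV_cmult[OF mixture_has_real_derivative[OF \<open>0 < t\<close>, of "n + k"], of "(- 1) ^ k"] by simp
  qed (use that in auto)
  note step = this
  have eq: "0 < t \<Longrightarrow> (deriv ^^ k) f t = (- 1) ^ k * mixture (n + k) t" for k t
  proof (induction k arbitrary: t)
    case (Suc k)
    from DERIV_imp_deriv[OF step[OF \<open>0 < t\<close> Suc.IH]] show ?case
      by simp
  qed (simp add: assms)
  show "(deriv ^^ k) f t = (- 1) ^ k * mixture (n + k) t"
    by (rule eq[OF \<open>0 < t\<close>])
  show "(deriv ^^ k) f differentiable (at t)"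
    using step[OF \<open>0 < t\<close> eq] real_differentiable_def by blast
qed

text \<open>The primitive \<open>- mixture 0\<close> tends to minus the mass of
  \<open>\<kappa>\<close> as t tends to 0 from the right, by dominated convergence. At T it equals
  \<open>- mixture 0 T\<close>, which is strictly negative; this makes the inequality strict.
  \<open>mixture 1\<close> itself may be unbounded near 0, hence the improper form of the
  fundamental theorem.\<close>

lemma integral_mixture:
  assumes "0 < T"
  shows "set_integrable lborel {0<..<T} (mixture 1)"
    and "(LINT t:{0<..<T}|lborel. mixture 1 t) < integral\<^sup>L lborel \<kappa>"
proof -
  have cont: "isCont (mixture n) t" if "0 < t" for n t
    using mixture_has_real_derivative[OF that] by (rule DERIV_isCont)
  have "((\<lambda>t. - mixture 0 t) \<longlongrightarrow> - integral\<^sup>L lborel \<kappa>) (at_right 0)"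
    unfolding tendsto_at_iff_sequentially comp_def mixture_def
  proof (safe intro!: tendsto_minus)
    fix X :: "nat \<Rightarrow> real"
    assume X: "\<forall>i. X i \<in> {0<..} - {0}" "X \<longlonglongrightarrow> 0"
    show "(\<lambda>i. \<integral>x. exp x ^ 0 * exp (- X i * exp x) * \<kappa> x \<partial>lborel) \<longlonglongrightarrow> integral\<^sup>L lborel \<kappa>"
    proof (rule integral_dominated_convergence[where w = \<kappa>])
      have "(\<lambda>i. exp x ^ 0 * exp (- X i * exp x) * \<kappa> x) \<longlonglongrightarrow> exp x ^ 0 * exp (- 0 * exp x) * \<kappa> x" for x
        by (intro tendsto_intros X)
      then show "AE x in lborel. (\<lambda>i. exp x ^ 0 * exp (- X i * exp x) * \<kappa> x) \<longlonglongrightarrow> \<kappa> x"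
        by simp
      show "AE x in lborel. norm (exp x ^ 0 * exp (- X i * exp x) * \<kappa> x) \<le> \<kappa> x" for i
        using X \<kappa>_pos by (auto simp: abs_mult less_imp_le mult_le_cancel_right1 less_eq_real_def)
    qed (use \<kappa>_integrable in auto)
  qed
  then have A: "(((\<lambda>t. - mixture 0 t) \<circ> real_of_ereal) \<longlongrightarrow> - integral\<^sup>L lborel \<kappa>) (at_right (ereal 0))"
    by (simp add: ereal_tendsto_simps)
  have "((\<lambda>t. - mixture 0 t) \<longlongrightarrow> - mixture 0 T) (at_left T)"
    using cont[OF assms, of 0] by (intro tendsto_minus) (auto simp: isCont_def intro: tendsto_within_subset)
  then have B: "(((\<lambda>t. - mixture 0 t) \<circ> real_of_ereal) \<longlongrightarrow> - mixture 0 T) (at_left (ereal T))"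
    by (simp add: ereal_tendsto_simps)
  have deriv: "((\<lambda>t. - mixture 0 t) has_real_derivative mixture 1 t) (at t)" if "0 < t" for t
    using DERIV_minus[OF mixture_has_real_derivative[OF that, of 0]] by simp
  have nonneg: "AE t in lborel. ereal 0 < ereal t \<longrightarrow> ereal t < ereal T \<longrightarrow> 0 \<le> mixture 1 t"
    using mixture_pos by (auto simp: less_imp_le)
  have FTC: "set_integrable lborel (einterval (ereal 0) (ereal T)) (mixture 1)"
    "(LBINT t=ereal 0..ereal T. mixture 1 t) = - mixture 0 T - - integral\<^sup>L lborel \<kappa>"
    by (rule interval_integral_FTC_nonneg[OF _ _ _ nonneg A B]; use assms deriv cont in force)+
  have ivl: "einterval (ereal 0) (ereal T) = {0<..<T}"
    by (auto simp: einterval_def)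
  show "set_integrable lborel {0<..<T} (mixture 1)"
    using FTC(1) unfolding ivl .
  have "ereal 0 \<le> ereal T"
    using assms by simp
  then have "(LBINT t=ereal 0..ereal T. mixture 1 t) = (LINT t:{0<..<T}|lborel. mixture 1 t)"
    by (simp only: interval_lebesgue_integral_def ivl if_True)
  then show "(LINT t:{0<..<T}|lborel. mixture 1 t) < integral\<^sup>L lborel \<kappa>"
    using FTC(2) mixture_pos[OF assms, of 0] by linarith
qed

lemma nn_integral_exp_decay:
  assumes "0 < (a :: real)"
  shows "(\<integral>\<^sup>+t. ennreal (exp (- a * t)) * indicator {0<..} t \<partial>lborel) = ennreal (1 / a)"
proof -
  have "(\<integral>\<^sup>+t. ennreal (exp (- a * t)) * indicator {0<..} t \<partial>lborel)
      = (\<integral>\<^sup>+t. ennreal (exp (- a * t)) * indicator {0..} t \<partial>lborel)"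
    using AE_lborel_singleton[of "0::real"]
    by (intro nn_integral_cong_AE, elim eventually_mono) (simp add: indicator_def)
  also have "\<dots> = ennreal (0 - - (exp (- a * 0) / a))"
  proof (rule nn_integral_FTC_atLeast)
    show "((\<lambda>t. - (exp (- a * t) / a)) \<longlongrightarrow> 0) at_top"
      using assms by real_asymp
  qed (use assms in \<open>auto intro!: derivative_eq_intros\<close>)
  finally show ?thesis
    by simp
qed

text \<open>Tonelli: everything is nonnegative, and the inner integral of exp (- (exp x + s) t) over
  t > 0 is 1 / (exp x + s). Finiteness is supplied by the Stieltjes integrability alone.\<close>

lemma laplace_mixture:
  assumes "0 < s"
    and stieltjes: "integrable lborel (\<lambda>x. \<kappa> x * exp x / (exp x + s))"
  shows "has_bochner_integral lborel (\<lambda>t. indicator {0<..} t * (exp (- s * t) * mixture 1 t))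
      (\<integral>x. \<kappa> x * exp x / (exp x + s) \<partial>lborel)"
proof (rule has_bochner_integral_nn_integral)
  have "mixture 1 = (\<lambda>t. \<integral>x. exp x ^ 1 * exp (- t * exp x) * \<kappa> x \<partial>lborel)"
    by (simp add: mixture_def fun_eq_iff)
  then show [measurable]: "(\<lambda>t. indicator {0<..} t * (exp (- s * t) * mixture 1 t)) \<in> borel_measurable lborel"
    by simp
  have pos: "0 < exp x + s" for x
    using \<open>0 < s\<close> by (rule add_pos_pos[OF exp_gt_zero])
  have nonneg: "0 \<le> \<kappa> x * exp x / (exp x + s)" for x
    using pos[of x] by (intro divide_nonneg_pos mult_nonneg_nonneg less_imp_le[OF \<kappa>_pos]) auto
  show "AE t in lborel. 0 \<le> indicator {0<..} t * (exp (- s * t) * mixture 1 t)"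
    using mixture_pos by (auto simp: indicator_def less_imp_le)
  show "0 \<le> (\<integral>x. \<kappa> x * exp x / (exp x + s) \<partial>lborel)"
    using nonneg by (intro integral_nonneg_AE) auto
  have "(\<integral>\<^sup>+t. ennreal (indicator {0<..} t * (exp (- s * t) * mixture 1 t)) \<partial>lborel)
      = (\<integral>\<^sup>+t. \<integral>\<^sup>+x. indicator {0<..} t * ennreal (exp (- s * t) * (exp x * exp (- t * exp x) * \<kappa> x)) \<partial>lborel \<partial>lborel)"
  proof (rule nn_integral_cong)
    fix t :: real
    show "ennreal (indicator {0<..} t * (exp (- s * t) * mixture 1 t))
      = (\<integral>\<^sup>+x. indicator {0<..} t * ennreal (exp (- s * t) * (exp x * exp (- t * exp x) * \<kappa> x)) \<partial>lborel)"
    proof (cases "0 < t")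
      case True
      have "(\<integral>\<^sup>+x. ennreal (exp (- s * t) * (exp x * exp (- t * exp x) * \<kappa> x)) \<partial>lborel)
          = ennreal (\<integral>x. exp (- s * t) * (exp x * exp (- t * exp x) * \<kappa> x) \<partial>lborel)"
        using mixture_integrable[OF True, of 1] \<kappa>_pos
        by (intro nn_integral_eq_integral) (auto simp: less_imp_le)
      then show ?thesis
        using True by (simp add: mixture_def)
    qed auto
  qed
  also have "\<dots> = (\<integral>\<^sup>+x. \<integral>\<^sup>+t. indicator {0<..} t * ennreal (exp (- s * t) * (exp x * exp (- t * exp x) * \<kappa> x)) \<partial>lborel \<partial>lborel)"
    by (rule lborel_pair.Fubini') (auto simp: case_prod_unfold)
  also have "\<dots> = (\<integral>\<^sup>+x. ennreal (\<kappa> x * exp x / (exp x + s)) \<partial>lborel)"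
  proof (rule nn_integral_cong)
    fix x :: real
    have "(\<integral>\<^sup>+t. indicator {0<..} t * ennreal (exp (- s * t) * (exp x * exp (- t * exp x) * \<kappa> x)) \<partial>lborel)
        = (\<integral>\<^sup>+t. ennreal (\<kappa> x * exp x) * (ennreal (exp (- (exp x + s) * t)) * indicator {0<..} t) \<partial>lborel)"
    proof (rule nn_integral_cong)
      fix t :: real
      have "exp (- s * t) * (exp x * exp (- t * exp x) * \<kappa> x) = \<kappa> x * exp x * exp (- (exp x + s) * t)"
        by (simp add: algebra_simps exp_add exp_diff exp_minus divide_inverse)
      then have "ennreal (exp (- s * t) * (exp x * exp (- t * exp x) * \<kappa> x))
          = ennreal (\<kappa> x * exp x) * ennreal (exp (- (exp x + s) * t))"
        using \<kappa>_pos[of x] by (simp only: ennreal_mult exp_ge_zero less_imp_le mult_nonneg_nonneg)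
      then show "indicator {0<..} t * ennreal (exp (- s * t) * (exp x * exp (- t * exp x) * \<kappa> x))
          = ennreal (\<kappa> x * exp x) * (ennreal (exp (- (exp x + s) * t)) * indicator {0<..} t)"
        by (simp only: mult_ac)
    qed
    also have "\<dots> = ennreal (\<kappa> x * exp x) * ennreal (1 / (exp x + s))"
      by (subst nn_integral_cmult) (simp_all only: nn_integral_exp_decay[OF pos], measurable)
    also have "\<dots> = ennreal (\<kappa> x * exp x / (exp x + s))"
      using \<kappa>_pos[of x] pos[of x] by (simp add: less_imp_le flip: ennreal_mult')
    finally show "(\<integral>\<^sup>+t. indicator {0<..} t * ennreal (exp (- s * t) * (exp x * exp (- t * exp x) * \<kappa> x)) \<partial>lborel)
        = ennreal (\<kappa> x * exp x / (exp x + s))" .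
  qed
  also have "\<dots> = ennreal (\<integral>x. \<kappa> x * exp x / (exp x + s) \<partial>lborel)"
    using nonneg by (intro nn_integral_eq_integral stieltjes) auto
  finally show "(\<integral>\<^sup>+t. ennreal (indicator {0<..} t * (exp (- s * t) * mixture 1 t)) \<partial>lborel)
      = ennreal (\<integral>x. \<kappa> x * exp x / (exp x + s) \<partial>lborel)" .
qed

end

text \<open>Substituting \<open>x = exp (- t)\<close> turns the hypothesis into the vanishing of all moments on
  \<open>[0, 1]\<close>, so by Weierstrass the integral against any continuous function of \<open>x\<close> vanishes; test
  with a tent around \<open>t0\<close>.\<close>

lemma laplace_transform_eq_0_imp_eq_0:
  fixes h :: "real \<Rightarrow> real"
  assumes cont: "continuous_on {0<..} h"
    and lap: "\<And>n::nat. has_bochner_integral lborel (\<lambda>t. indicator {0<..} t * (exp (- (s0 + n) * t) * h t)) 0"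
    and t0: "0 < t0"
  shows "h t0 = 0"
proof (rule ccontr)
  assume "h t0 \<noteq> 0"
  \<comment> \<open>Absorbing \<open>exp (- s0 * t)\<close> into the weight makes it integrable, and
    the hypothesis at s0 + n becomes the n-th moment in exp (- t).\<close>
  define w where "w t = indicator {0<..} t * (exp (- s0 * t) * h t)" for t
  have w: "integrable lborel w"
    using lap[of 0] by (simp add: has_bochner_integral_iff w_def[abs_def])
  then have w_measurable [measurable]: "w \<in> borel_measurable borel"
    using borel_measurable_integrable by force
  have moment: "has_bochner_integral lborel (\<lambda>t. w t * exp (- t) ^ n) 0" for n
  proof -
    have "w t * exp (- t) ^ n = indicator {0<..} t * (exp (- (s0 + n) * t) * h t)" for t
      by (simp add: w_def algebra_simps flip: exp_of_nat_mult exp_add)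
    then show ?thesis
      using lap[of n] by simp
  qed
  have bounded_int: "integrable lborel (\<lambda>t. w t * \<phi> (exp (- t)))" if "continuous_on UNIV \<phi>" for \<phi> :: "real \<Rightarrow> real"
  proof -
    have "compact (\<phi> ` {0..1})"
      using that by (intro compact_continuous_image) (auto intro: continuous_on_subset)
    then obtain C where C: "\<And>x. x \<in> {0..1} \<Longrightarrow> \<bar>\<phi> x\<bar> \<le> C"
      using compact_imp_bounded bounded_real by (metis imageI)
    have [measurable]: "\<phi> \<in> borel_measurable borel"
      using that by (rule borel_measurable_continuous_onI)
    show ?thesis
    proof (rule Bochner_Integration.integrable_bound[of _ "\<lambda>t. C * w t"])
      show "AE t in lborel. norm (w t * \<phi> (exp (- t))) \<le> norm (C * w t)"
      proof (rule AE_I2)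
        fix t
        show "norm (w t * \<phi> (exp (- t))) \<le> norm (C * w t)"
        proof (cases "0 < t")
          case True
          then have "\<bar>\<phi> (exp (- t))\<bar> \<le> C"
            by (intro C) auto
          then have "\<bar>\<phi> (exp (- t))\<bar> \<le> \<bar>C\<bar>"
            by linarith
          from mult_left_mono[OF this, of "\<bar>w t\<bar>"] show ?thesis
            by (simp add: abs_mult mult.commute)
        qed (simp add: w_def)
      qed
    qed (simp_all add: w)
  qed
  have zero: "(\<integral>t. w t * \<phi> (exp (- t)) \<partial>lborel) = 0" if \<phi>: "continuous_on UNIV \<phi>" for \<phi> :: "real \<Rightarrow> real"
  proof -
    have le: "\<bar>\<integral>t. w t * \<phi> (exp (- t)) \<partial>lborel\<bar> \<le> e * (\<integral>t. \<bar>w t\<bar> \<partial>lborel)" if "0 < e" for e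
    proof -
      obtain p where p: "real_polynomial_function p" "\<And>x. x \<in> {0..1} \<Longrightarrow> \<bar>\<phi> x - p x\<bar> < e"
        using Stone_Weierstrass_real_polynomial_function[of "{0..1}" \<phi> e] \<phi> \<open>0 < e\<close>
        by (metis compact_Icc continuous_on_subset subset_UNIV)
      obtain a n where p_eq: "p = (\<lambda>x. \<Sum>i\<le>n. a i * x ^ i)"
        using p(1) unfolding real_polynomial_function_iff_sum by blast
      have "has_bochner_integral lborel (\<lambda>t. \<Sum>i\<le>n. a i * (w t * exp (- t) ^ i)) (\<Sum>i\<le>n. a i * 0)"
        by (intro has_bochner_integral_sum has_bochner_integral_mult_right moment)
      then have pw: "has_bochner_integral lborel (\<lambda>t. w t * p (exp (- t))) 0"
        by (simp add: p_eq sum_distrib_left mult_ac)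
      then have "(\<integral>t. w t * \<phi> (exp (- t)) \<partial>lborel) = (\<integral>t. w t * \<phi> (exp (- t)) - w t * p (exp (- t)) \<partial>lborel)"
        using bounded_int[OF \<phi>] by (simp add: has_bochner_integral_iff)
      also have "\<bar>\<dots>\<bar> \<le> (\<integral>t. e * \<bar>w t\<bar> \<partial>lborel)"
      proof (rule order.trans[OF integral_abs_bound integral_mono])
        show "integrable lborel (\<lambda>t. \<bar>w t * \<phi> (exp (- t)) - w t * p (exp (- t))\<bar>)"
          using pw bounded_int[OF \<phi>] by (auto simp: has_bochner_integral_iff)
        show "\<bar>w t * \<phi> (exp (- t)) - w t * p (exp (- t))\<bar> \<le> e * \<bar>w t\<bar>" for t
        proof (cases "0 < t")
          case True
          then have "\<bar>\<phi> (exp (- t)) - p (exp (- t))\<bar> < e"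
            by (intro p) auto
          then have "\<bar>w t\<bar> * \<bar>\<phi> (exp (- t)) - p (exp (- t))\<bar> \<le> \<bar>w t\<bar> * e"
            by (intro mult_left_mono) auto
          then show ?thesis
            by (simp add: abs_mult mult.commute flip: right_diff_distrib)
        qed (simp add: w_def)
      qed (simp add: w)
      finally show ?thesis
        by simp
    qed
    have "\<bar>\<integral>t. w t * \<phi> (exp (- t)) \<partial>lborel\<bar> \<le> 0"
    proof (rule tendsto_lowerbound)
      show "((\<lambda>e. e * (\<integral>t. \<bar>w t\<bar> \<partial>lborel)) \<longlongrightarrow> 0) (at_right 0)"
        by (auto intro!: tendsto_eq_intros)
      show "\<forall>\<^sub>F e in at_right 0. \<bar>\<integral>t. w t * \<phi> (exp (- t)) \<partial>lborel\<bar> \<le> e * (\<integral>t. \<bar>w t\<bar> \<partial>lborel)"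
        using eventually_at_right_less[of 0] by eventually_elim (rule le)
    qed simp
    then show ?thesis
      by simp
  qed
  obtain d where d: "0 < d" "d < t0" and sgn: "\<And>t. \<bar>t - t0\<bar> < d \<Longrightarrow> 0 < sgn (h t0) * h t"
  proof -
    have "isCont h t0"
      using cont t0 by (simp add: continuous_on_eq_continuous_at)
    then obtain e where "0 < e" and e: "\<And>t. \<bar>t - t0\<bar> < e \<Longrightarrow> \<bar>h t - h t0\<bar> < \<bar>h t0\<bar>"
      using \<open>h t0 \<noteq> 0\<close> unfolding continuous_at_eps_delta dist_real_def by (metis zero_less_abs_iff)
    have "0 < sgn (h t0) * h t" if "\<bar>t - t0\<bar> < min e (t0 / 2)" for t
      using e[of t] that by (auto simp: sgn_if abs_if split: if_splits)
    then show thesis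
      using \<open>0 < e\<close> t0 by (intro that[of "min e (t0 / 2)"]) auto
  qed
  \<comment> \<open>The tent in t becomes a function of x = exp (- t) through \<open>ln\<close>.
    Cutting x off below at \<open>c\<close> keeps it continuous on the whole line and changes
    nothing, since the tent is 0 beyond t0 + d.\<close>
  define c where "c = exp (- (t0 + d))"
  define \<phi> where "\<phi> x = sgn (h t0) * max 0 (d - \<bar>ln (max x c) + t0\<bar>)" for x
  have "continuous_on UNIV \<phi>"
    unfolding \<phi>_def by (intro continuous_intros) (auto simp: c_def max_def not_le intro: order.strict_trans[OF exp_gt_zero])
  have \<phi>_exp: "\<phi> (exp (- t)) = sgn (h t0) * max 0 (d - \<bar>t - t0\<bar>)" for t
  proof (cases "t \<le> t0 + d")
    case True
    then have "max (exp (- t)) c = exp (- t)"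
      by (simp add: c_def)
    then show ?thesis
      by (simp add: \<phi>_def abs_minus_commute)
  next
    case False
    then have "max (exp (- t)) c = c"
      by (simp add: c_def)
    then show ?thesis
      using False d by (simp add: \<phi>_def c_def)
  qed
  have nonneg: "0 \<le> w t * \<phi> (exp (- t))" and pos: "\<bar>t - t0\<bar> < d \<Longrightarrow> 0 < w t * \<phi> (exp (- t))" for t
  proof -
    show "0 < w t * \<phi> (exp (- t))" if t: "\<bar>t - t0\<bar> < d"
    proof -
      have "0 < t"
        using t d by linarith
      then have "w t * \<phi> (exp (- t)) = exp (- s0 * t) * (sgn (h t0) * h t) * (d - \<bar>t - t0\<bar>)"
        using t by (simp add: w_def \<phi>_exp max_def)
      also have "\<dots> > 0"
        by (intro mult_pos_pos[OF mult_pos_pos] sgn t exp_gt_zero) (use t in simp)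
      finally show ?thesis .
    qed
    moreover have "w t * \<phi> (exp (- t)) = 0" if "\<not> \<bar>t - t0\<bar> < d"
      using that by (simp add: \<phi>_exp)
    ultimately show "0 \<le> w t * \<phi> (exp (- t))"
      by (cases "\<bar>t - t0\<bar> < d") auto
  qed
  have "AE t in lborel. w t * \<phi> (exp (- t)) = 0"
    using zero[OF \<open>continuous_on UNIV \<phi>\<close>] nonneg
      integral_nonneg_eq_0_iff_AE[OF bounded_int[OF \<open>continuous_on UNIV \<phi>\<close>]] by simp
  moreover have "t \<notin> {t0 - d<..<t0 + d}" if "w t * \<phi> (exp (- t)) = 0" for t
    using pos[of t] that by (auto simp: abs_less_iff)
  ultimately have "AE t in lborel. t \<notin> {t0 - d<..<t0 + d}"
    by (rule eventually_mono)
  moreover have "{t \<in> space lborel. \<not> t \<notin> {t0 - d<..<t0 + d}} = {t0 - d<..<t0 + d}"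
    by auto
  ultimately have "emeasure lborel {t0 - d<..<t0 + d} = 0"
    using AE_iff_measurable[of "{t0 - d<..<t0 + d}" lborel "\<lambda>t. t \<notin> {t0 - d<..<t0 + d}"] by simp
  then show False
    using d by simp
qed

section \<open>Laplace transform of the multinomial Mittag-Leffler kernel\<close>

definition multi_indices :: "nat \<Rightarrow> nat \<Rightarrow> nat list set" where
  "multi_indices n k = {l. length l = n \<and> sum_list l = k}"

lemma multi_indices_Suc:
  "multi_indices (Suc n) k = (\<lambda>(j, l). j # l) ` (SIGMA j:{..k}. multi_indices n (k - j))"
proof (intro set_eqI iffI)
  fix l assume "l \<in> multi_indices (Suc n) k"
  then obtain j l' where "l = j # l'" "length l' = n" "j + sum_list l' = k"
    by (cases l) (auto simp: multi_indices_def)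
  then show "l \<in> (\<lambda>(j, l). j # l) ` (SIGMA j:{..k}. multi_indices n (k - j))"
    by (intro image_eqI[of _ _ "(j, l')"]) (auto simp: multi_indices_def)
qed (auto simp: multi_indices_def)

lemma finite_multi_indices [simp]: "finite (multi_indices n k)"
proof (induction n arbitrary: k)
  case 0
  have "multi_indices 0 k \<subseteq> {[]}"
    by (auto simp: multi_indices_def)
  then show ?case
    by (rule finite_subset) simp
qed (auto simp: multi_indices_Suc)

text \<open>Splitting off the first exponent j leaves a binomial coefficient times the multinomial
  sum of degree k - j over the tail, so the binomial theorem closes the induction.\<close>

lemma multinomial_theorem_list:
  fixes zs :: "'a::field_char_0 list"
  shows "(\<Sum>l\<in>multi_indices (length zs) k.
      fact k / (\<Prod>i<length zs. fact (l ! i)) * (\<Prod>i<length zs. zs ! i ^ (l ! i))) = sum_list zs ^ k"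
proof (induction zs arbitrary: k)
  case Nil
  have "multi_indices 0 k = (if k = 0 then {[]} else {})"
    by (auto simp: multi_indices_def)
  then show ?case
    by simp
next
  case (Cons z zs)
  let ?n = "length zs"
  let ?c = "\<lambda>k l. fact k / (\<Prod>i<?n. fact (l ! i)) * (\<Prod>i<?n. zs ! i ^ (l ! i)) :: 'a"
  have inj: "inj_on (\<lambda>(j, l). j # l) (SIGMA j:{..k}. multi_indices ?n (k - j))"
    by (auto simp: inj_on_def)
  have "(\<Sum>l\<in>multi_indices (length (z # zs)) k.
        fact k / (\<Prod>i<length (z # zs). fact (l ! i)) * (\<Prod>i<length (z # zs). (z # zs) ! i ^ (l ! i)))
      = (\<Sum>(j, l)\<in>(SIGMA j:{..k}. multi_indices ?n (k - j)).
          fact k / (fact j * (\<Prod>i<?n. fact (l ! i))) * (z ^ j * (\<Prod>i<?n. zs ! i ^ (l ! i))))"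
    unfolding list.size(4) add_Suc_right add_0_right multi_indices_Suc sum.reindex[OF inj]
    by (intro sum.cong) (auto simp: prod.lessThan_Suc_shift simp del: prod.lessThan_Suc)
  also have "\<dots> = (\<Sum>j\<le>k. \<Sum>l\<in>multi_indices ?n (k - j).
      fact k / (fact j * (\<Prod>i<?n. fact (l ! i))) * (z ^ j * (\<Prod>i<?n. zs ! i ^ (l ! i))))"
    by (rule sum.Sigma[symmetric]) auto
  also have "\<dots> = (\<Sum>j\<le>k. of_nat (k choose j) * z ^ j * (\<Sum>l\<in>multi_indices ?n (k - j). ?c (k - j) l))"
  proof (intro sum.cong refl)
    fix j assume "j \<in> {..k}"
    then have choose: "of_nat (k choose j) = (fact k / (fact j * fact (k - j)) :: 'a)"
      by (simp add: binomial_fact)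
    show "(\<Sum>l\<in>multi_indices ?n (k - j).
          fact k / (fact j * (\<Prod>i<?n. fact (l ! i))) * (z ^ j * (\<Prod>i<?n. zs ! i ^ (l ! i))))
        = of_nat (k choose j) * z ^ j * (\<Sum>l\<in>multi_indices ?n (k - j). ?c (k - j) l)"
      unfolding choose sum_distrib_left by (intro sum.cong) auto
  qed
  also have "\<dots> = (\<Sum>j\<le>k. of_nat (k choose j) * z ^ j * sum_list zs ^ (k - j))"
    by (simp only: Cons.IH)
  also have "\<dots> = sum_list (z # zs) ^ k"
    by (simp add: binomial_ring)
  finally show ?case .
qed

text \<open>Euler's integral for \<open>Gamma z\<close> after the substitution of s * t for
  t.\<close>

lemma laplace_powr:
  fixes s z :: real
  assumes "0 < s" "0 < z"
  shows "has_bochner_integral lborel (\<lambda>t. indicator {0<..} t * (exp (- s * t) * t powr (z - 1)))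
      (Gamma z * s powr (- z))"
proof -
  have "(\<integral>\<^sup>+t. ennreal (indicator {0..} t * t powr (z - 1) / exp t) \<partial>lborel) = ennreal (Gamma z)"
    by (rule Gamma_conv_nn_integral_real[OF assms(2), symmetric])
  then have "has_bochner_integral lborel (\<lambda>t. indicator {0..} t * t powr (z - 1) / exp t) (Gamma z)"
    using Gamma_real_pos[OF assms(2)] by (intro has_bochner_integral_nn_integral) auto
  then have "has_bochner_integral lborel
      (\<lambda>t. indicator {0..} (0 + s * t) * (0 + s * t) powr (z - 1) / exp (0 + s * t)) (Gamma z /\<^sub>R \<bar>s\<bar>)"
    using assms by (subst (asm) lborel_has_bochner_integral_real_affine_iff[where c = s and t = 0]) auto
  from has_bochner_integral_mult_right[OF this, of "s powr (1 - z)"]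
  have "has_bochner_integral lborel
      (\<lambda>t. s powr (1 - z) * (indicator {0..} (s * t) * (s * t) powr (z - 1) / exp (s * t)))
      (s powr (1 - z) * (Gamma z /\<^sub>R s))"
    using assms by simp
  moreover have "s powr (1 - z) * (indicator {0..} (s * t) * (s * t) powr (z - 1) / exp (s * t))
      = indicator {0<..} t * (exp (- s * t) * t powr (z - 1))" for t
  proof (cases "0 < t")
    case True
    have "s powr (1 - z) * s powr (z - 1) = 1"
      using assms by (simp flip: powr_add)
    with True assms show ?thesis
      by (simp add: powr_mult exp_minus divide_inverse)
  next
    \<comment> \<open>At t = 0 the two indicators differ, but both sides are 0 because
      \<open>0 powr (z - 1) = 0\<close>.\<close>
    case False
    then show ?thesis
      using assms by (cases "t = 0") (auto simp: indicator_def zero_le_mult_iff)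
  qed
  moreover have "s powr (1 - z) * (Gamma z /\<^sub>R s) = Gamma z * s powr (- z)"
    using assms by (simp add: powr_diff powr_minus divide_inverse)
  ultimately show ?thesis
    by (simp only:)
qed

section \<open>The Mittag-Leffler series and its Laplace transform\<close>

locale multinomial_series =
  fixes \<beta>s Zs :: "real list" and \<alpha> :: real
  assumes \<alpha>: "0 < \<alpha>"
    and length_Zs: "length Zs = length \<beta>s"
    and \<beta>s: "\<And>i. i < length \<beta>s \<Longrightarrow> 0 < \<beta>s ! i"
    and Zs: "\<And>i. i < length \<beta>s \<Longrightarrow> 0 < Zs ! i"
begin

definition expo :: "nat list \<Rightarrow> real" where
  "expo l = (\<Sum>i<length \<beta>s. \<beta>s ! i * real (l ! i))"

definition coef :: "nat \<Rightarrow> nat list \<Rightarrow> real" where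
  "coef k l = fact k / (\<Prod>i<length \<beta>s. fact (l ! i)) * (\<Prod>i<length \<beta>s. Zs ! i ^ (l ! i))"

text \<open>Each argument of the Mittag-Leffler function is minus a positive multiple of a power of
  t, so the part of degree k has the common sign (-1)^k. What is left after removing it is
  nonnegative and increasing in t, and all estimates use this.\<close>

definition abs_term :: "nat \<Rightarrow> real \<Rightarrow> real" where
  "abs_term k t = (\<Sum>l\<in>multi_indices (length \<beta>s) k. coef k l * (t powr expo l / Gamma (\<alpha> + expo l)))"

text \<open>The common ratio of the geometric series formed by the Laplace transforms of the
  homogeneous parts.\<close>

definition ratio :: "real \<Rightarrow> real" where
  "ratio s = (\<Sum>i<length \<beta>s. Zs ! i * s powr (- (\<beta>s ! i)))"

definition kernel :: "real \<Rightarrow> real" where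
  "kernel t = t powr (\<alpha> - 1) * (\<Sum>k. (- 1) ^ k * abs_term k t)"

lemma expo_nonneg: "0 \<le> expo l"
  unfolding expo_def using \<beta>s by (intro sum_nonneg mult_nonneg_nonneg) (auto simp: less_imp_le)

lemma coef_nonneg: "0 \<le> coef k l"
  unfolding coef_def using Zs
  by (intro mult_nonneg_nonneg divide_nonneg_nonneg prod_nonneg zero_le_power) (auto simp: less_imp_le)

lemma Gamma_expo_pos: "0 < Gamma (\<alpha> + expo l)"
  using \<alpha> expo_nonneg[of l] by (intro Gamma_real_pos) linarith

lemma abs_term_nonneg: "0 \<le> abs_term k t"
  unfolding abs_term_def
  by (intro sum_nonneg mult_nonneg_nonneg coef_nonneg divide_nonneg_pos Gamma_expo_pos) simp

lemma abs_term_mono: "0 \<le> s \<Longrightarrow> s \<le> t \<Longrightarrow> abs_term k s \<le> abs_term k t"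
  unfolding abs_term_def
  by (intro sum_mono mult_left_mono coef_nonneg divide_right_mono less_imp_le[OF Gamma_expo_pos]
      powr_mono2 expo_nonneg)

lemma multinomial_ML_eq_abs_term:
  assumes "0 < t" and "length zs = length \<beta>s"
    and zs: "\<And>i. i < length \<beta>s \<Longrightarrow> zs ! i = - (Zs ! i * t powr (\<beta>s ! i))"
  shows "t powr (\<alpha> - 1) * multinomial_ML \<beta>s \<alpha> zs = kernel t"
proof -
  have "fact k / (\<Prod>i<length zs. fact (l ! i)) * ((\<Prod>i<length zs. zs ! i ^ (l ! i)) / Gamma (\<alpha> + (\<Sum>i<length zs. \<beta>s ! i * real (l ! i))))
      = (- 1) ^ k * (coef k l * (t powr expo l / Gamma (\<alpha> + expo l)))"
    if l: "l \<in> multi_indices (length \<beta>s) k" for k l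
  proof -
    have "(\<Prod>i<length \<beta>s. zs ! i ^ (l ! i))
        = (\<Prod>i<length \<beta>s. (- 1) ^ (l ! i) * (Zs ! i ^ (l ! i) * t powr (\<beta>s ! i * real (l ! i))))"
      using \<open>0 < t\<close> by (intro prod.cong refl)
        (simp add: zs power_mult_distrib powr_power power_minus[of "_ * _"] mult.commute)
    also have "\<dots> = (- 1) ^ (\<Sum>i<length \<beta>s. l ! i) * ((\<Prod>i<length \<beta>s. Zs ! i ^ (l ! i)) * t powr expo l)"
      using \<open>0 < t\<close> by (simp add: prod.distrib power_sum expo_def powr_sum)
    also have "(\<Sum>i<length \<beta>s. l ! i) = k"
      using l sum_list_sum_nth[of l] by (auto simp: multi_indices_def atLeast0LessThan)
    finally show ?thesis
      by (simp add: assms(2) coef_def expo_def)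
  qed
  then have "multinomial_ML \<beta>s \<alpha> zs = (\<Sum>k. (- 1) ^ k * abs_term k t)"
    unfolding multinomial_ML_def abs_term_def sum_distrib_left assms(2) multi_indices_def[symmetric]
    by (intro suminf_cong sum.cong) (simp_all add: assms(2))
  then show ?thesis
    by (simp add: kernel_def)
qed

text \<open>The Gamma factor produced by each power of t cancels the one in the denominator of its
  coefficient. The remaining sum is the multinomial expansion of a k-th power.\<close>

lemma laplace_abs_term:
  assumes "0 < s"
  shows "has_bochner_integral lborel
    (\<lambda>t. indicator {0<..} t * (exp (- s * t) * (t powr (\<alpha> - 1) * abs_term k t))) (s powr (- \<alpha>) * ratio s ^ k)"
proof -
  have "has_bochner_integral lborel
      (\<lambda>t. \<Sum>l\<in>multi_indices (length \<beta>s) k. coef k l / Gamma (\<alpha> + expo l) *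
        (indicator {0<..} t * (exp (- s * t) * t powr (\<alpha> + expo l - 1))))
      (\<Sum>l\<in>multi_indices (length \<beta>s) k. coef k l / Gamma (\<alpha> + expo l) * (Gamma (\<alpha> + expo l) * s powr (- (\<alpha> + expo l))))"
    using \<alpha> expo_nonneg assms
    by (intro has_bochner_integral_sum has_bochner_integral_mult_right laplace_powr) (auto intro: add_pos_nonneg)
  moreover have "(\<Sum>l\<in>multi_indices (length \<beta>s) k. coef k l / Gamma (\<alpha> + expo l) *
        (indicator {0<..} t * (exp (- s * t) * t powr (\<alpha> + expo l - 1))))
      = indicator {0<..} t * (exp (- s * t) * (t powr (\<alpha> - 1) * abs_term k t))" for t
  proof -
    have "t powr (\<alpha> + expo l - 1) = t powr (\<alpha> - 1) * t powr expo l" for l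
      by (simp flip: powr_add add: algebra_simps)
    then show ?thesis
      by (simp add: abs_term_def sum_distrib_left mult_ac)
  qed
  moreover have "(\<Sum>l\<in>multi_indices (length \<beta>s) k. coef k l / Gamma (\<alpha> + expo l) * (Gamma (\<alpha> + expo l) * s powr (- (\<alpha> + expo l))))
      = s powr (- \<alpha>) * ratio s ^ k"
  proof -
    define zs where "zs = map (\<lambda>i. Zs ! i * s powr (- (\<beta>s ! i))) [0..<length \<beta>s]"
    have len: "length zs = length \<beta>s"
      by (simp add: zs_def)
    have "sum_list zs = ratio s"
      by (simp add: zs_def ratio_def interv_sum_list_conv_sum_set_nat atLeast0LessThan)
    then have "ratio s ^ k = (\<Sum>l\<in>multi_indices (length \<beta>s) k.
        fact k / (\<Prod>i<length \<beta>s. fact (l ! i)) * (\<Prod>i<length \<beta>s. zs ! i ^ (l ! i)))"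
      using multinomial_theorem_list[where zs = zs and k = k] by (simp add: len)
    also have "\<dots> = (\<Sum>l\<in>multi_indices (length \<beta>s) k. coef k l * s powr (- expo l))"
    proof (intro sum.cong refl)
      fix l
      have "(\<Prod>i<length \<beta>s. zs ! i ^ (l ! i)) = (\<Prod>i<length \<beta>s. Zs ! i ^ (l ! i) * s powr (- (\<beta>s ! i * real (l ! i))))"
        using assms by (intro prod.cong refl) (simp add: zs_def power_mult_distrib powr_power mult.commute)
      also have "\<dots> = (\<Prod>i<length \<beta>s. Zs ! i ^ (l ! i)) * s powr (- expo l)"
        using assms by (simp add: prod.distrib expo_def powr_sum sum_negf[symmetric])
      finally show "fact k / (\<Prod>i<length \<beta>s. fact (l ! i)) * (\<Prod>i<length \<beta>s. zs ! i ^ (l ! i)) = coef k l * s powr (- expo l)"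
        by (simp add: coef_def)
    qed
    finally have "s powr (- \<alpha>) * ratio s ^ k = (\<Sum>l\<in>multi_indices (length \<beta>s) k. s powr (- \<alpha>) * (coef k l * s powr (- expo l)))"
      by (simp add: sum_distrib_left)
    also have "\<dots> = (\<Sum>l\<in>multi_indices (length \<beta>s) k. coef k l / Gamma (\<alpha> + expo l) * (Gamma (\<alpha> + expo l) * s powr (- (\<alpha> + expo l))))"
    proof (intro sum.cong refl)
      fix l
      have "s powr (- (\<alpha> + expo l)) = s powr (- \<alpha>) * s powr (- expo l)"
        by (simp flip: powr_add)
      then show "s powr (- \<alpha>) * (coef k l * s powr (- expo l)) = coef k l / Gamma (\<alpha> + expo l) * (Gamma (\<alpha> + expo l) * s powr (- (\<alpha> + expo l)))"
        using Gamma_expo_pos[of l] by simp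
    qed
    finally show ?thesis ..
  qed
  ultimately show ?thesis
    by simp
qed

lemma ratio_nonneg: "0 \<le> ratio s"
  unfolding ratio_def using Zs by (intro sum_nonneg mult_nonneg_nonneg) (auto simp: less_imp_le)

lemma ratio_small:
  obtains s0 where "0 < s0" "\<And>s. s0 \<le> s \<Longrightarrow> ratio s < 1"
proof -
  have "((\<lambda>s. Zs ! i * s powr (- (\<beta>s ! i))) \<longlongrightarrow> 0) at_top" if "i < length \<beta>s" for i
    using \<beta>s[OF that] by real_asymp
  then have "((\<lambda>s. \<Sum>i<length \<beta>s. Zs ! i * s powr (- (\<beta>s ! i))) \<longlongrightarrow> (\<Sum>i<length \<beta>s. 0)) at_top"
    by (intro tendsto_sum) auto
  then have "(ratio \<longlongrightarrow> 0) at_top"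
    by (simp add: ratio_def[abs_def])
  then have "\<forall>\<^sub>F s in at_top. ratio s < 1"
    by (rule order_tendstoD) simp
  then have "\<forall>\<^sub>F s in at_top. ratio s < 1 \<and> 0 < s"
    using eventually_gt_at_top[of 0] by (rule eventually_conj)
  then obtain s0 where "\<And>s. s0 \<le> s \<Longrightarrow> ratio s < 1 \<and> 0 < s"
    unfolding eventually_at_top_linorder by blast
  then show thesis
    by (intro that[of s0]) auto
qed

text \<open>Since the terms increase in \<open>t\<close>, each is bounded by a fixed multiple of its own Laplace
  transform, and those form a geometric series; no asymptotics of \<open>Gamma\<close> are needed.\<close>

lemma summable_abs_term:
  assumes "0 < t"
  shows "summable (\<lambda>k. abs_term k t)"
proof -
  obtain s where s: "0 < s" "ratio s < 1"
    using ratio_small by (metis order_refl)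
  \<comment> \<open>A lower bound for exp (- s r) * r powr (\<alpha> - 1) on [t, t + 1]; writing the
    power as r powr \<alpha> / r allows the numerator to be bounded at t and the denominator at t +
    1.\<close>
  define C where "C = exp (- s * (t + 1)) * (t powr \<alpha> / (t + 1))"
  have "0 < C"
    using assms by (simp add: C_def)
  have "norm (abs_term k t) \<le> 1 / C * (s powr (- \<alpha>) * ratio s ^ k)" for k
  proof -
    have lap: "integrable lborel (\<lambda>r. indicator {0<..} r * (exp (- s * r) * (r powr (\<alpha> - 1) * abs_term k r)))"
      "(\<integral>r. indicator {0<..} r * (exp (- s * r) * (r powr (\<alpha> - 1) * abs_term k r)) \<partial>lborel) = s powr (- \<alpha>) * ratio s ^ k"
      using laplace_abs_term[OF s(1), of k] by (auto simp: has_bochner_integral_iff)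
    have "C * abs_term k t = (\<integral>r. indicator {t..t + 1} r * (C * abs_term k t) \<partial>lborel)"
      by simp
    also have "\<dots> \<le> (\<integral>r. indicator {0<..} r * (exp (- s * r) * (r powr (\<alpha> - 1) * abs_term k r)) \<partial>lborel)"
    proof (rule integral_mono)
      fix r :: real
      show "indicator {t..t + 1} r * (C * abs_term k t) \<le> indicator {0<..} r * (exp (- s * r) * (r powr (\<alpha> - 1) * abs_term k r))"
      proof (cases "r \<in> {t..t + 1}")
        case True
        then have r: "t \<le> r" "r \<le> t + 1" "0 < r"
          using assms by auto
        have "t powr \<alpha> / (t + 1) \<le> r powr \<alpha> / r"
          using r assms \<alpha> by (intro frac_le powr_mono2) auto
        also have "\<dots> = r powr (\<alpha> - 1)"
          using r by (simp add: powr_diff)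
        finally have "C \<le> exp (- s * r) * r powr (\<alpha> - 1)"
          unfolding C_def using r s assms by (intro mult_mono) auto
        then have "C * abs_term k t \<le> exp (- s * r) * r powr (\<alpha> - 1) * abs_term k r"
          using r assms \<open>0 < C\<close> by (intro mult_mono abs_term_mono abs_term_nonneg) auto
        then show ?thesis
          using True r by (simp add: mult.assoc)
      qed (auto simp: indicator_def intro!: mult_nonneg_nonneg abs_term_nonneg)
    qed (use lap in simp_all)
    also have "\<dots> = s powr (- \<alpha>) * ratio s ^ k"
      by (rule lap(2))
    finally show ?thesis
      using \<open>0 < C\<close> abs_term_nonneg[of k t] by (simp add: field_simps)
  qed
  moreover have "summable (\<lambda>k. 1 / C * (s powr (- \<alpha>) * ratio s ^ k))"
    using s ratio_nonneg[of s] by (intro summable_mult summable_geometric) simp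
  ultimately show ?thesis
    by (rule summable_comparison_test'[where N = 0, rotated])
qed

text \<open>By monotonicity the summable values at t + 1 majorize the series on the interval (0, t +
  1), so Weierstrass' M-test applies.\<close>

lemma continuous_on_kernel: "continuous_on {0<..} kernel"
proof -
  have "isCont (\<lambda>t. \<Sum>k. (- 1) ^ k * abs_term k t) t" if "0 < t" for t
  proof -
    have "uniform_limit {0<..<t + 1} (\<lambda>n r. \<Sum>k<n. (- 1) ^ k * abs_term k r) (\<lambda>r. \<Sum>k. (- 1) ^ k * abs_term k r) sequentially"
    proof (rule Weierstrass_m_test)
      show "norm ((- 1) ^ k * abs_term k r) \<le> abs_term k (t + 1)" if "r \<in> {0<..<t + 1}" for k r
        using that abs_term_nonneg abs_term_mono[of r "t + 1" k] by (simp add: abs_mult)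
      show "summable (\<lambda>k. abs_term k (t + 1))"
        using that by (intro summable_abs_term) simp
    qed
    moreover have "continuous_on {0<..<t + 1} (\<lambda>r. \<Sum>k<n. (- 1) ^ k * abs_term k r)" for n
      unfolding abs_term_def using Gamma_expo_pos
      by (intro continuous_intros) (auto simp: less_imp_neq[symmetric])
    ultimately have "continuous_on {0<..<t + 1} (\<lambda>t. \<Sum>k. (- 1) ^ k * abs_term k t)"
      by (intro uniform_limit_theorem[of _ _ sequentially]) auto
    then show ?thesis
      using that by (simp add: continuous_on_eq_continuous_at)
  qed
  then have "continuous_on {0<..} (\<lambda>t. \<Sum>k. (- 1) ^ k * abs_term k t)"
    by (intro continuous_at_imp_continuous_on) auto
  then show ?thesis
    unfolding kernel_def[abs_def] by (intro continuous_intros) auto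
qed

text \<open>The integrals of the absolute values form a convergent geometric series when
  \<open>ratio s < 1\<close>, which justifies the exchange of sum and integral. The alternating
  signs then turn 1 - \<open>ratio s\<close> into 1 + \<open>ratio s\<close> in the
  denominator.\<close>

lemma laplace_kernel:
  assumes "0 < s" "ratio s < 1"
  shows "has_bochner_integral lborel (\<lambda>t. indicator {0<..} t * (exp (- s * t) * kernel t))
    (s powr (- \<alpha>) / (1 + ratio s))"
proof -
  define F where "F k t = (- 1) ^ k * (indicator {0<..} t * (exp (- s * t) * (t powr (\<alpha> - 1) * abs_term k t)))" for k t
  have norm_F: "norm (F k t) = indicator {0<..} t * (exp (- s * t) * (t powr (\<alpha> - 1) * abs_term k t))" for k t
    by (simp add: F_def abs_mult abs_term_nonneg)
  have F: "has_bochner_integral lborel (F k) ((- 1) ^ k * (s powr (- \<alpha>) * ratio s ^ k))" for k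
    unfolding F_def[abs_def] by (intro has_bochner_integral_mult_right laplace_abs_term assms)
  have norm_F_int: "(\<integral>t. norm (F k t) \<partial>lborel) = s powr (- \<alpha>) * ratio s ^ k" for k
    unfolding norm_F using laplace_abs_term[OF assms(1), of k] by (simp add: has_bochner_integral_iff)
  have summable_t: "summable (\<lambda>k. abs_term k t)" if "0 < t" for t
    using that by (rule summable_abs_term)
  have int: "integrable lborel (F k)" for k
    using F[of k] by (simp add: has_bochner_integral_iff)
  have ae: "AE t in lborel. summable (\<lambda>k. norm (F k t))"
  proof (rule AE_I2)
    fix t :: real
    show "summable (\<lambda>k. norm (F k t))"
      unfolding norm_F using summable_t[of t] by (cases "0 < t") (auto intro!: summable_mult)
  qed
  have "norm (ratio s) < 1"
    using assms ratio_nonneg[of s] by simp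
  then have "summable (\<lambda>k. \<integral>t. norm (F k t) \<partial>lborel)"
    unfolding norm_F_int by (intro summable_mult summable_geometric)
  note sums = integrable_suminf[OF int ae this] sums_integral[OF int ae this]
  have F_sum: "(\<Sum>k. F k t) = indicator {0<..} t * (exp (- s * t) * kernel t)" for t
  proof (cases "0 < t")
    case True
    have "F k t = exp (- s * t) * t powr (\<alpha> - 1) * ((- 1) ^ k * abs_term k t)" for k
      using True by (simp add: F_def)
    moreover have "summable (\<lambda>k. (- 1) ^ k * abs_term k t)"
      by (rule summable_norm_cancel) (use summable_t[OF True] abs_term_nonneg in \<open>simp add: abs_mult\<close>)
    ultimately show ?thesis
      using True by (simp add: kernel_def suminf_mult mult.assoc)
  qed (simp add: F_def)
  have "(\<lambda>k. s powr (- \<alpha>) * (- ratio s) ^ k) sums (s powr (- \<alpha>) * (1 / (1 - - ratio s)))"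
    using \<open>norm (ratio s) < 1\<close> by (intro sums_mult geometric_sums) simp
  moreover have "s powr (- \<alpha>) * (- ratio s) ^ k = integral\<^sup>L lborel (F k)" for k
    using F[of k] power_minus[of "ratio s" k] by (simp add: has_bochner_integral_iff)
  ultimately have "(\<lambda>k. integral\<^sup>L lborel (F k)) sums (s powr (- \<alpha>) / (1 + ratio s))"
    by simp
  then have "(\<integral>t. (\<Sum>k. F k t) \<partial>lborel) = s powr (- \<alpha>) / (1 + ratio s)"
    using sums(2) sums_unique2 by blast
  then show ?thesis
    using sums(1) by (simp add: has_bochner_integral_iff F_sum)
qed

end

section \<open>Identification of the kernel\<close>

lemma E_bar_completely_monotone:
  fixes \<alpha> \<mu> T :: real and a b :: "nat \<Rightarrow> real"
  assumes \<alpha>: "0 < \<alpha>" "\<alpha> < 1" and \<mu>: "0 < \<mu>"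
    and a: "\<And>i. 1 \<le> i \<Longrightarrow> i \<le> m \<Longrightarrow> 0 < a i \<and> a i < \<alpha>"
    and b: "\<And>i. 1 \<le> i \<Longrightarrow> i \<le> m \<Longrightarrow> 0 < b i"
  shows "completely_monotone (E_bar m \<alpha> a b \<mu>)"
    and "0 < T \<Longrightarrow> set_integrable lborel {0<..<T} (\<lambda>t. \<bar>E_bar m \<alpha> a b \<mu> t\<bar>)"
    and "0 < T \<Longrightarrow> (LINT t:{0<..<T}|lborel. \<bar>E_bar m \<alpha> a b \<mu> t\<bar>) < 1 / \<mu>"
proof -
  \<comment> \<open>Index 0 plays two roles: in the symbol it is the leading term s powr \<alpha>
    with coefficient 1, while in \<open>\<beta>s\<close> and \<open>Zs\<close> it is the argument
    with coefficient \<mu>, which is the constant term of the symbol.\<close>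
  define c p where "c i = (if i = 0 then 1 else b i)" and "p i = (if i = 0 then \<alpha> else a i)" for i
  define \<beta>s where "\<beta>s = \<alpha> # map (\<lambda>i. \<alpha> - a i) [1..<m + 1]"
  define Zs where "Zs = \<mu> # map b [1..<m + 1]"
  have lens: "length \<beta>s = Suc m" "length Zs = Suc m"
    by (simp_all add: \<beta>s_def Zs_def)
  have nth: "\<beta>s ! i = (if i = 0 then \<alpha> else \<alpha> - a i)" "Zs ! i = (if i = 0 then \<mu> else b i)" if "i < Suc m" for i
    using that by (auto simp: \<beta>s_def Zs_def nth_Cons split: nat.split simp del: upt_Suc)
  have ai: "0 < a i" "a i < \<alpha>" "0 < b i" if "i < Suc m" "i \<noteq> 0" for i
    using a[of i] b[of i] that by auto
  interpret S: exponential_symbol "{..<Suc m}" c p \<mu>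
    by unfold_locales (use \<alpha> \<mu> ai in \<open>force simp: c_def p_def\<close>)+
  interpret X: exponential_mixture S.density
    by unfold_locales (auto simp: S.density_pos S.density_integral)
  interpret Ser: multinomial_series \<beta>s Zs \<alpha>
    by unfold_locales (use \<alpha> \<mu> ai in \<open>auto simp: lens nth\<close>)
  have E_bar: "E_bar m \<alpha> a b \<mu> t = Ser.kernel t" if "0 < t" for t
    unfolding E_bar_def \<beta>s_def[symmetric]
  proof (rule Ser.multinomial_ML_eq_abs_term[OF that])
    fix i assume "i < length \<beta>s"
    then show "(- \<mu> * t powr \<alpha> # map (\<lambda>i. - b i * t powr (\<alpha> - a i)) [1..<m + 1]) ! i
        = - (Zs ! i * t powr (\<beta>s ! i))"
      by (auto simp: lens nth nth_Cons split: nat.split simp del: upt_Suc)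
  qed (simp add: lens)
  \<comment> \<open>Factoring s powr \<alpha> out of the symbol matches the two indexings: the
    leading term becomes 1 and the rest becomes \<open>Ser.ratio s\<close>.\<close>
  have Dr: "1 / S.Dr (ln s) = s powr (- \<alpha>) / (1 + Ser.ratio s)" if "0 < s" for s
  proof -
    have "S.Dr (ln s) = \<mu> + (s powr \<alpha> + (\<Sum>i<m. b (Suc i) * s powr a (Suc i)))"
      using that unfolding S.Dr_def sum.lessThan_Suc_shift by (simp add: c_def p_def powr_def)
    also have "\<dots> = s powr \<alpha> * (1 + (\<mu> * s powr (- \<alpha>) + (\<Sum>i<m. b (Suc i) * s powr (- (\<alpha> - a (Suc i))))))"
    proof -
      have "s powr \<alpha> * s powr (- \<alpha>) = 1"
        using that by (simp flip: powr_add)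
      moreover have "s powr \<alpha> * s powr (- (\<alpha> - r)) = s powr r" for r
        by (simp flip: powr_add)
      ultimately show ?thesis
        by (simp add: distrib_left sum_distrib_left mult.left_commute[of "s powr \<alpha>"])
    qed
    also have "\<mu> * s powr (- \<alpha>) + (\<Sum>i<m. b (Suc i) * s powr (- (\<alpha> - a (Suc i)))) = Ser.ratio s"
      unfolding Ser.ratio_def lens sum.lessThan_Suc_shift by (simp add: nth)
    finally show ?thesis
      by (simp add: powr_minus divide_inverse)
  qed
  obtain s0 where s0: "0 < s0" "\<And>s. s0 \<le> s \<Longrightarrow> Ser.ratio s < 1"
    using Ser.ratio_small by blast
  \<comment> \<open>Beyond s0 the series has a Laplace transform, and it agrees with that of the
    mixture; the progression s0 + n stays in this range.\<close>
  have "Ser.kernel t - X.mixture 1 t = 0" if "0 < t" for t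
  proof (rule laplace_transform_eq_0_imp_eq_0[OF _ _ that])
    show "continuous_on {0<..} (\<lambda>t. Ser.kernel t - X.mixture 1 t)"
      by (intro continuous_intros Ser.continuous_on_kernel continuous_at_imp_continuous_on ballI
          DERIV_isCont[OF X.mixture_has_real_derivative]) simp
    fix n :: nat
    have s: "0 < s0 + n" "Ser.ratio (s0 + n) < 1"
      using s0 by auto
    have "has_bochner_integral lborel
        (\<lambda>t. indicator {0<..} t * (exp (- (s0 + n) * t) * Ser.kernel t)
          - indicator {0<..} t * (exp (- (s0 + n) * t) * X.mixture 1 t))
        (1 / S.Dr (ln (s0 + n)) - 1 / S.Dr (ln (s0 + n)))"
      using Ser.laplace_kernel[OF s] X.laplace_mixture[OF s(1) S.stieltjes_representation(1)[OF s(1)]]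
      unfolding S.stieltjes_representation(2)[OF s(1)] Dr[OF s(1)]
      by (rule has_bochner_integral_diff)
    then show "has_bochner_integral lborel
        (\<lambda>t. indicator {0<..} t * (exp (- (s0 + n) * t) * (Ser.kernel t - X.mixture 1 t))) 0"
      by (simp add: right_diff_distrib)
  qed
  then have eq: "E_bar m \<alpha> a b \<mu> t = X.mixture 1 t" if "0 < t" for t
    using E_bar that by simp
  show "completely_monotone (E_bar m \<alpha> a b \<mu>)"
    unfolding completely_monotone_def
  proof (intro conjI allI impI)
    fix k and t :: real
    assume "0 < t"
    note deriv = X.iterated_deriv_mixture[OF eq \<open>0 < t\<close>, of k]
    show "(deriv ^^ k) (E_bar m \<alpha> a b \<mu>) differentiable at t"
      by (rule deriv(2))
    show "0 \<le> (- 1) ^ k * (deriv ^^ k) (E_bar m \<alpha> a b \<mu>) t"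
      using X.mixture_pos[OF \<open>0 < t\<close>] by (simp add: deriv(1) less_imp_le flip: mult.assoc power_mult_distrib)
  qed
  assume "0 < T"
  have abs_eq: "\<bar>E_bar m \<alpha> a b \<mu> t\<bar> = X.mixture 1 t" if "t \<in> {0<..<T}" for t
    using that eq[of t] X.mixture_pos[of t 1] by simp
  show "set_integrable lborel {0<..<T} (\<lambda>t. \<bar>E_bar m \<alpha> a b \<mu> t\<bar>)"
    using X.integral_mixture(1)[OF \<open>0 < T\<close>] by (subst set_integrable_cong[OF refl refl abs_eq]) auto
  have "(LINT t:{0<..<T}|lborel. \<bar>E_bar m \<alpha> a b \<mu> t\<bar>) = (LINT t:{0<..<T}|lborel. X.mixture 1 t)"
    by (rule set_lebesgue_integral_cong) (auto simp: abs_eq)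
  then show "(LINT t:{0<..<T}|lborel. \<bar>E_bar m \<alpha> a b \<mu> t\<bar>) < 1 / \<mu>"
    using X.integral_mixture(2)[OF \<open>0 < T\<close>] by (simp add: S.density_integral)
qed

text \<open>The sequence \<open>lam\<close> enumerates the set of eigenvalues in any order and
  possibly with repetitions. Integrability is stated as a separate conjunct because the integral of
  a function that is not integrable is 0 by convention.\<close>

theorem lemma2p4:
  fixes \<Omega> :: "'a::euclidean_space set"
    and T \<alpha> :: real
    and m :: nat
    and a b lam :: "nat \<Rightarrow> real"
  assumes "DIM('a) \<in> {1, 2, 3}"
    and "convex_polyhedral_domain \<Omega>"
    and "0 < T"
    and "0 < \<alpha>" and "\<alpha> < 1"
    and "\<And>i. 1 \<le> i \<Longrightarrow> i \<le> m \<Longrightarrow> 0 < a i \<and> a i < \<alpha>"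
    and "\<And>i j. 1 \<le> i \<Longrightarrow> i \<le> j \<Longrightarrow> j \<le> m \<Longrightarrow> a j \<le> a i"
    and "\<And>i. 1 \<le> i \<Longrightarrow> i \<le> m \<Longrightarrow> 0 < b i"
    and "lam ` {1..} = {\<mu>. dirichlet_eigenvalue \<Omega> \<mu>}"
  shows "\<forall>j\<ge>1. completely_monotone (E_bar m \<alpha> a b (lam j)) \<and>
           set_integrable lborel {0<..<T} (\<lambda>t. \<bar>E_bar m \<alpha> a b (lam j) t\<bar>) \<and>
           (LINT t:{0<..<T}|lborel. \<bar>E_bar m \<alpha> a b (lam j) t\<bar>) < 1 / lam j"
proof (intro allI impI)
  fix j :: nat
  assume "1 \<le> j"
  then have "dirichlet_eigenvalue \<Omega> (lam j)"
    using assms(9) by blast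
  \<comment> \<open>Positivity is not among the hypotheses on \<open>lam\<close>; it follows from
    openness and boundedness of \<Omega>.\<close>
  then have "0 < lam j"
    using assms(2) by (intro dirichlet_eigenvalue_pos[of \<Omega>]) (auto simp: convex_polyhedral_domain_def)
  with assms show "completely_monotone (E_bar m \<alpha> a b (lam j)) \<and>
      set_integrable lborel {0<..<T} (\<lambda>t. \<bar>E_bar m \<alpha> a b (lam j) t\<bar>) \<and>
      (LINT t:{0<..<T}|lborel. \<bar>E_bar m \<alpha> a b (lam j) t\<bar>) < 1 / lam j"
    by (intro conjI E_bar_completely_monotone) auto
qed

end
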